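(* Let $(\Sigma_T,\sigma)$ be a one-sided subshift of finite type with primitive adjacency matrix $T$, and let $\Phi=(\varphi_n)_{n\in\mathbb{N}}$ be a superadditive sequence of potentials on $\Sigma_T$. Then $P_{\mathrm{top}}(\Phi,\sigma)=P_{\mathrm{meas}}(\Phi,\sigma)$.
   Context: $T$ is a primitive $q\times q$ matrix with entries in $\{0,1\}$; $\Sigma_T=\{x\in\{1,\dots,q\}^{\mathbb{N}_0}:T_{x_i,x_{i+1}}=1\ \forall i\ge 0\}$ with the product topology; $\sigma$ is the left shift. $\mathcal{C}_n$ is the set of admissible words of length $n$ (words all of whose consecutive pairs $(a,b)$ satisfy $T_{a,b}=1$), and $[I]$ is the cylinder of points of $\Sigma_T$ beginning with $I$. $\mathcal{M}(\Sigma_T,\sigma)$ is the set of $\sigma$-invariant Borel probability measures and $h(\mu,\sigma)$ is the measure-theoretic entropy. A sequence $\Phi=(\varphi_n)_{n\in\mathbb{N}}$ of functions $\varphi_n:\Sigma_T\to\mathbb{R}$ is superadditive if each $\varphi_n$ is continuous and $\varphi_{n+m}(x)\ge\varphi_n(x)+\varphi_m(\sigma^n x)$ for all $n,m\in\mathbb{N}$, $x\in\Sigma_T$. For such $\Phi$ define $\mathcal{F}_*(\mu)=\lim_{n\to\infty}\frac1n\int\varphi_n\,d\mu=\sup_n\frac1n\int\varphi_n\,d\mu\in(-\infty,\infty]$ for $\mu\in\mathcal{M}(\Sigma_T,\sigma)$; $P_{\mathrm{meas}}(\Phi,\sigma)=\sup\{h(\mu,\sigma)+\mathcal{F}_*(\mu):\mu\in\mathcal{M}(\Sigma_T,\sigma)\}$;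 and $P_{\mathrm{top}}(\Phi,\sigma)=\lim_{n\to\infty}\frac1n\log\sum_{I\in\mathcal{C}_n}e^{\inf_{x\in[I]}\varphi_n(x)}$ (this limit exists in $(-\infty,\infty]$). *)

theory Defs
  imports "HOL-Probability.Probability" "Jordan_Normal_Form.Matrix"
begin

section \<open>Subshifts of finite type\<close>

text \<open>Symbols are the row and column indices of the matrix, so the alphabet of a \<open>q \<times> q\<close> matrix
  is \<open>{0, ..., q - 1}\<close>. Points are functions of type \<open>nat \<Rightarrow> nat\<close>, whose topology is the product of
  the discrete topology on \<open>nat\<close>; the subshift carries the subspace topology.\<close>

definition primitive_mat :: "nat mat \<Rightarrow> bool" where
  "primitive_mat T \<longleftrightarrow>
     square_mat T \<and> (\<exists>k\<ge>1. \<forall>i<dim_row T. \<forall>j<dim_row T. (T ^\<^sub>m k) $$ (i, j) > 0)"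

definition subshift :: "nat mat \<Rightarrow> (nat \<Rightarrow> nat) set" where
  "subshift T = {x. \<forall>i. x i < dim_row T \<and> T $$ (x i, x (Suc i)) = 1}"

definition shift :: "(nat \<Rightarrow> 'a) \<Rightarrow> (nat \<Rightarrow> 'a)" where
  "shift x = (\<lambda>i. x (Suc i))"

definition admissible_words :: "nat mat \<Rightarrow> nat \<Rightarrow> nat list set" where
  "admissible_words T n = {w. length w = n \<and> set w \<subseteq> {..<dim_row T} \<and>
     (\<forall>i. Suc i < n \<longrightarrow> T $$ (w ! i, w ! Suc i) = 1)}"

definition cylinder :: "nat mat \<Rightarrow> nat list \<Rightarrow> (nat \<Rightarrow> nat) set" where
  "cylinder T w = {x \<in> subshift T. \<forall>i<length w. x i = w ! i}"

definition invariant_measures :: "nat mat \<Rightarrow> (nat \<Rightarrow> nat) measure set" where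
  "invariant_measures T =
     {\<mu>. prob_space \<mu> \<and> sets \<mu> = sets (restrict_space borel (subshift T)) \<and> distr \<mu> \<mu> shift = \<mu>}"


section \<open>Measure-theoretic (Kolmogorov--Sinai) entropy\<close>

definition finite_measurable_partition :: "'a measure \<Rightarrow> 'a set set \<Rightarrow> bool" where
  "finite_measurable_partition M P \<longleftrightarrow> finite P \<and> P \<subseteq> sets M \<and> partition_on (space M) P"

definition partition_entropy :: "'a measure \<Rightarrow> 'a set set \<Rightarrow> real" where
  "partition_entropy M P = - (\<Sum>A\<in>P. measure M A * ln (measure M A))"

text \<open>The join of \<open>f\<^sup>-\<^sup>i P\<close> for \<open>i < n\<close>. It may contain the empty set, which contributes nothing to
  the entropy.\<close>

definition iterated_join :: "'a measure \<Rightarrow> ('a \<Rightarrow> 'a) \<Rightarrow> 'a set set \<Rightarrow> nat \<Rightarrow> 'a set set" where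
  "iterated_join M f P n =
     {{x \<in> space M. \<forall>i<n. (f ^^ i) x \<in> c i} | c. \<forall>i<n. c i \<in> P}"

definition entropy_wrt_partition :: "'a measure \<Rightarrow> ('a \<Rightarrow> 'a) \<Rightarrow> 'a set set \<Rightarrow> ereal" where
  "entropy_wrt_partition M f P =
     lim (\<lambda>n. ereal (partition_entropy M (iterated_join M f P n) / real n))"

definition KS_entropy :: "'a measure \<Rightarrow> ('a \<Rightarrow> 'a) \<Rightarrow> ereal" where
  "KS_entropy M f = (SUP P \<in> {P. finite_measurable_partition M P}. entropy_wrt_partition M f P)"


section \<open>Superadditive potentials and their pressures\<close>

text \<open>The sequence \<open>\<Phi>\<close> is indexed by the positive integers; \<open>\<Phi> 0\<close> is irrelevant. Likewise only the
  values of \<open>\<Phi> n\<close> on the subshift matter.\<close>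

definition superadditive :: "nat mat \<Rightarrow> (nat \<Rightarrow> (nat \<Rightarrow> nat) \<Rightarrow> real) \<Rightarrow> bool" where
  "superadditive T \<Phi> \<longleftrightarrow>
     (\<forall>n\<ge>1. continuous_on (subshift T) (\<Phi> n)) \<and>
     (\<forall>n\<ge>1. \<forall>m\<ge>1. \<forall>x\<in>subshift T. \<Phi> (n + m) x \<ge> \<Phi> n x + \<Phi> m ((shift ^^ n) x))"

definition asymptotic_mean ::
    "(nat \<Rightarrow> (nat \<Rightarrow> nat) \<Rightarrow> real) \<Rightarrow> (nat \<Rightarrow> nat) measure \<Rightarrow> ereal" where
  "asymptotic_mean \<Phi> \<mu> = lim (\<lambda>n. ereal ((\<integral>x. \<Phi> n x \<partial>\<mu>) / real n))"

definition P_meas :: "nat mat \<Rightarrow> (nat \<Rightarrow> (nat \<Rightarrow> nat) \<Rightarrow> real) \<Rightarrow> ereal" where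
  "P_meas T \<Phi> = (SUP \<mu> \<in> invariant_measures T. KS_entropy \<mu> shift + asymptotic_mean \<Phi> \<mu>)"

definition P_top :: "nat mat \<Rightarrow> (nat \<Rightarrow> (nat \<Rightarrow> nat) \<Rightarrow> real) \<Rightarrow> ereal" where
  "P_top T \<Phi> = lim (\<lambda>n. ereal
     (ln (\<Sum>w\<in>admissible_words T n. exp (INF x\<in>cylinder T w. \<Phi> n x)) / real n))"

end

theory Submission
  imports Defs
begin

text \<open>
  Lower bound for \<open>P_top\<close>: let \<open>\<mu>\<close> be invariant and \<open>P\<close> a finite partition. Up to a small error, the
  \<open>P\<close>-itinerary of a point is a function of its letters. Gibbs' inequality, applied to the joint law of
  the itinerary and the word of length \<open>n\<close>, therefore bounds the entropy of the itinerary plus the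
  integral of \<open>inf \<Phi> n\<close> over cylinders by the logarithm of the partition function, up to \<open>o(n)\<close>. By
  superadditivity and uniform continuity of \<open>\<Phi> m\<close> that integral is at least \<open>n / m\<close> times the
  integral of \<open>\<Phi> m\<close>, up to a small multiple of \<open>n\<close>; now let \<open>m\<close> tend to infinity.

  Upper bound for \<open>P_top\<close>: for fixed \<open>m\<close>, draw independent admissible words of length \<open>m\<close> with
  probabilities proportional to \<open>exp (inf \<Phi> m)\<close>, join them by connecting paths of bounded length
  (primitivity), and average the resulting law over the starting position in a block. This is an
  invariant measure whose entropy plus mean is at least \<open>(ln (Z m) - B) / (m + K - 1)\<close>, where \<open>Z m\<close> is
  the partition function and neither \<open>B\<close> nor \<open>K\<close> depends on \<open>m\<close>. No limit of measures is taken, so no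
  semicontinuity is needed.
\<close>

section \<open>Entropy of finite-valued random variables\<close>

text \<open>A weak limit of measures supported on heavy words would be the classical way to realise
  \<open>P_top\<close>. Here it breaks down: the asymptotic mean is a supremum of continuous
  functionals, hence only lower semicontinuous, and it may drop in the limit. A measure built from
  one fixed \<open>m\<close> escapes this, since superadditivity bounds its mean from below by what
  a single block contributes. The weights proportional to \<open>exp (psi m w)\<close> are those for
  which Gibbs' inequality is an equality: the entropy per word is \<open>ln (Z m)\<close> minus the
  mean of \<open>psi m\<close>, so the mean cancels and \<open>ln (Z m)\<close> remains. In the
  other direction there are two obstacles. No bound on the oscillation of \<open>\<Phi> n\<close>
  over cylinders of length \<open>n\<close> is available as \<open>n\<close> grows, so points of a
  cylinder are compared only through \<open>\<Phi> m\<close> with \<open>m\<close> fixed. And the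
  entropy is a supremum over all finite measurable partitions, which cylinders only approximate; the
  approximation error must be paid at every time step and still be a small multiple of
  \<open>n\<close>. Both pressures may be infinite, so suprema over \<open>m\<close> and over
  partitions are taken last, in \<open>ereal\<close>.\<close>

definition info :: "'a measure \<Rightarrow> ('a \<Rightarrow> 'b) \<Rightarrow> 'a \<Rightarrow> real" where
  "info M X x = - ln (measure M {y \<in> space M. X y = X x})"

text \<open>Entropy as the mean of the information function lets two entropies be compared pointwise
  almost everywhere, without fixing a set of values.\<close>

definition rv_entropy :: "'a measure \<Rightarrow> ('a \<Rightarrow> 'b) \<Rightarrow> real" where
  "rv_entropy M X = (\<integral>x. info M X x \<partial>M)"

lemma info_cong:
  assumes "\<And>y. y \<in> space M \<Longrightarrow> X y = X x \<longleftrightarrow> Y y = Y x"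
  shows "info M X x = info M Y x"
  using assms unfolding info_def by (metis (mono_tags, lifting) Collect_cong)

lemma rv_entropy_cong:
  assumes "\<And>x y. x \<in> space M \<Longrightarrow> y \<in> space M \<Longrightarrow> X x = X y \<longleftrightarrow> Y x = Y y"
  shows "rv_entropy M X = rv_entropy M Y"
  unfolding rv_entropy_def by (rule Bochner_Integration.integral_cong) (auto intro!: info_cong simp: assms)

lemma simple_function_pair:
  assumes "simple_function M X" "simple_function M Y"
  shows "simple_function M (\<lambda>x. (X x, Y x))"
  using simple_function_compose2[OF assms, of Pair] by simp

lemma simple_function_sets:
  assumes "simple_function M X"
  shows "{x \<in> space M. X x = v} \<in> sets M"
proof -
  have "{x \<in> space M. X x = v} = X -` {v} \<inter> space M" by auto
  then show ?thesis using simple_functionD(2)[OF assms] by simp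
qed

context prob_space
begin

lemma integrable_simple:
  fixes f :: "'a \<Rightarrow> real"
  assumes "simple_function M f"
  shows "integrable M f"
proof (rule integrable_const_bound)
  have fin: "finite (f ` space M)" using assms by (rule simple_functionD)
  show "AE x in M. norm (f x) \<le> Max (norm ` f ` space M)"
    using fin by (intro AE_I2 Max_ge) auto
  show "f \<in> borel_measurable M" using assms by (rule borel_measurable_simple_function)
qed

lemma integrable_simple_compose:
  fixes g :: "'b \<Rightarrow> real"
  assumes "simple_function M X"
  shows "integrable M (\<lambda>x. g (X x))"
  using simple_function_compose1[OF assms, of g] by (rule integrable_simple)

lemma integral_simple:
  fixes g :: "'b \<Rightarrow> real"
  assumes X: "simple_function M X" and V: "finite V" "X ` space M \<subseteq> V"
  shows "(\<integral>x. g (X x) \<partial>M) = (\<Sum>v\<in>V. g v * prob {x \<in> space M. X x = v})"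
proof -
  have "(\<integral>x. g (X x) \<partial>M) = (\<integral>x. (\<Sum>v\<in>V. g v * indicator {x \<in> space M. X x = v} x) \<partial>M)"
  proof (rule Bochner_Integration.integral_cong[OF refl])
    fix x assume x: "x \<in> space M"
    have "(\<Sum>v\<in>V. g v * indicator {x \<in> space M. X x = v} x) = (\<Sum>v\<in>V. if v = X x then g v else 0)"
      using x by (intro sum.cong) (auto simp: indicator_def)
    then show "g (X x) = (\<Sum>v\<in>V. g v * indicator {x \<in> space M. X x = v} x)"
      using V x by auto
  qed
  also have "\<dots> = (\<Sum>v\<in>V. g v * prob {x \<in> space M. X x = v})"
  proof (subst Bochner_Integration.integral_sum)
    show "integrable M (\<lambda>x. g v * indicator {x \<in> space M. X x = v} x)" for v
      using simple_function_sets[OF X, of v]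
      by (intro integrable_mult_right integrable_real_indicator) (auto simp: less_top[symmetric])
    have "{x \<in> space M. X x = v} \<inter> space M = {x \<in> space M. X x = v}" for v by blast
    then show "(\<Sum>v\<in>V. \<integral>x. g v * indicator {x \<in> space M. X x = v} x \<partial>M) =
        (\<Sum>v\<in>V. g v * prob {x \<in> space M. X x = v})"
      by (intro sum.cong refl) simp
  qed
  finally show ?thesis .
qed

lemma integrable_info: "simple_function M X \<Longrightarrow> integrable M (info M X)"
  unfolding info_def by (rule integrable_simple_compose)

lemma rv_entropy_nonneg: "0 \<le> rv_entropy M X"
proof -
  have "ln (prob A) \<le> 0" for A
    using prob_le_1[of A] by (cases "prob A = 0") (auto simp: less_le)
  then show ?thesis
    unfolding rv_entropy_def by (intro Bochner_Integration.integral_nonneg) (auto simp: info_def)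
qed

lemma rv_entropy_eq_sum:
  assumes X: "simple_function M X" and V: "finite V" "X ` space M \<subseteq> V"
  shows "rv_entropy M X =
    - (\<Sum>v\<in>V. prob {x \<in> space M. X x = v} * ln (prob {x \<in> space M. X x = v}))"
  unfolding rv_entropy_def info_def
  by (subst integral_simple[OF X V]) (simp add: sum_negf mult.commute)

text \<open>There are finitely many atoms, so the null ones together form a null set. This confines
  the effect of the default value \<open>ln 0 = 0\<close> to a null set.\<close>

lemma AE_atom_pos:
  assumes X: "simple_function M X"
  shows "AE x in M. prob {y \<in> space M. X y = X x} > 0"
proof -
  let ?N = "X ` space M \<inter> {v. prob {y \<in> space M. X y = v} = 0}"
  have "AE x in M. x \<notin> {y \<in> space M. X y = v}" if "v \<in> ?N" for v
    using that simple_function_sets[OF X]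
    by (intro AE_not_in null_setsI) (auto simp: emeasure_eq_measure)
  moreover have "countable ?N"
    using simple_functionD(1)[OF X] by (simp add: countable_finite)
  ultimately have "AE x in M. \<forall>v\<in>?N. x \<notin> {y \<in> space M. X y = v}"
    by (subst AE_ball_countable) auto
  then show ?thesis
    by (rule AE_mp) (auto intro!: AE_I2 simp: less_le)
qed

text \<open>Integrate \<open>ln t \<le> t - 1\<close> at \<open>t = q (X x) / (P (X x) * Z)\<close>,
  with \<open>P\<close> the law of \<open>X\<close> and \<open>Z\<close> the total weight. The
  hypothesis \<open>pos\<close> guards against \<open>ln 0 = 0\<close>, by which a vanishing weight
  on a charged atom would count like weight 1.\<close>

lemma gibbs:
  fixes q :: "'b \<Rightarrow> real"
  assumes X: "simple_function M X" and V: "finite V" "X ` space M \<subseteq> V"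
    and nonneg: "\<And>v. v \<in> V \<Longrightarrow> q v \<ge> 0"
    and pos: "\<And>x. x \<in> space M \<Longrightarrow> prob {y \<in> space M. X y = X x} > 0 \<Longrightarrow> q (X x) > 0"
  shows "(\<integral>x. ln (q (X x)) \<partial>M) + rv_entropy M X \<le> ln (\<Sum>v\<in>V. q v)"
proof -
  define P where "P v = prob {y \<in> space M. X y = v}" for v
  define Z where "Z = (\<Sum>v\<in>V. q v)"
  have AEpos: "AE x in M. P (X x) > 0" using AE_atom_pos[OF X] by (simp add: P_def)
  have "\<exists>x\<in>space M. P (X x) > 0"
  proof (rule ccontr)
    assume "\<not> ?thesis"
    then have "AE x in M. False" using AEpos by (auto elim!: AE_mp intro!: AE_I2)
    then show False by simp
  qed
  then obtain x0 where x0: "x0 \<in> space M" "P (X x0) > 0" by auto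
  have "0 < q (X x0)" using x0 pos by (simp add: P_def)
  also have "\<dots> \<le> Z" unfolding Z_def using V x0 nonneg by (intro member_le_sum) auto
  finally have Z: "Z > 0" .
  have "(\<integral>x. ln (q (X x)) + info M X x - ln Z \<partial>M) \<le> (\<integral>x. q (X x) / (P (X x) * Z) - 1 \<partial>M)"
  proof (rule integral_mono_AE)
    show "integrable M (\<lambda>x. ln (q (X x)) + info M X x - ln Z)"
      "integrable M (\<lambda>x. q (X x) / (P (X x) * Z) - 1)"
      unfolding info_def by (intro integrable_simple_compose X)+
    show "AE x in M. ln (q (X x)) + info M X x - ln Z \<le> q (X x) / (P (X x) * Z) - 1"
      using AEpos
    proof (rule AE_mp, intro AE_I2 impI)
      fix x assume x: "x \<in> space M" "P (X x) > 0"
      then have q: "q (X x) > 0" using pos by (simp add: P_def)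
      have "ln (q (X x)) + info M X x - ln Z = ln (q (X x) / (P (X x) * Z))"
        using x q Z by (simp add: info_def P_def[symmetric] ln_div ln_mult)
      also have "\<dots> \<le> q (X x) / (P (X x) * Z) - 1" using x q Z by (intro ln_le_minus_one) auto
      finally show "ln (q (X x)) + info M X x - ln Z \<le> q (X x) / (P (X x) * Z) - 1" .
    qed
  qed
  also have "\<dots> = (\<integral>x. q (X x) / (P (X x) * Z) \<partial>M) - 1"
    by (subst Bochner_Integration.integral_diff[OF integrable_simple_compose[OF X]]) (auto simp: prob_space)
  also have "(\<integral>x. q (X x) / (P (X x) * Z) \<partial>M) = (\<Sum>v\<in>V. q v / (P v * Z) * P v)"
    unfolding P_def by (rule integral_simple[OF X V])
  \<comment> \<open>Only an inequality: where \<open>P v = 0\<close> the summand on the left is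
    0.\<close>
  also have "\<dots> \<le> (\<Sum>v\<in>V. q v / Z)"
    using nonneg Z by (intro sum_mono) auto
  also have "\<dots> = 1" using Z by (simp add: sum_divide_distrib[symmetric] Z_def)
  finally have "(\<integral>x. ln (q (X x)) + info M X x - ln Z \<partial>M) \<le> 0" by simp
  moreover have "(\<integral>x. ln (q (X x)) + info M X x - ln Z \<partial>M)
      = (\<integral>x. ln (q (X x)) \<partial>M) + rv_entropy M X - ln Z"
  proof -
    note int = integrable_simple_compose[OF X, of "\<lambda>v. ln (q v)"] integrable_info[OF X]
    show ?thesis unfolding rv_entropy_def
      by (subst Bochner_Integration.integral_diff[OF Bochner_Integration.integrable_add[OF int] integrable_const],
        subst Bochner_Integration.integral_add[OF int]) (simp add: prob_space)
  qed
  ultimately show ?thesis by (simp add: Z_def)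
qed

text \<open>Every atom of \<open>Y\<close> lies in an atom of \<open>X\<close>, so \<open>Y\<close>
  carries at least as much information at each point of a charged atom.\<close>

lemma rv_entropy_mono:
  assumes X: "simple_function M X" and Y: "simple_function M Y"
    and XY: "\<And>x y. x \<in> space M \<Longrightarrow> y \<in> space M \<Longrightarrow> Y x = Y y \<Longrightarrow> X x = X y"
  shows "rv_entropy M X \<le> rv_entropy M Y"
  unfolding rv_entropy_def
proof (rule integral_mono_AE[OF integrable_info[OF X] integrable_info[OF Y]])
  show "AE x in M. info M X x \<le> info M Y x"
    using AE_atom_pos[OF Y]
  proof (rule AE_mp, intro AE_I2 impI)
    fix x assume x: "x \<in> space M" "prob {y \<in> space M. Y y = Y x} > 0"
    have "prob {y \<in> space M. Y y = Y x} \<le> prob {y \<in> space M. X y = X x}"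
      using x(1) XY by (intro finite_measure_mono simple_function_sets[OF X]) blast
    then show "info M X x \<le> info M Y x" using x by (simp add: info_def)
  qed
qed

lemma sum_prob_simple:
  assumes X: "simple_function M X" and V: "finite V" "X ` space M \<subseteq> V"
  shows "(\<Sum>v\<in>V. prob {x \<in> space M. X x = v}) = 1"
  using integral_simple[OF X V, of "\<lambda>_. 1"] by (simp add: prob_space)

text \<open>Gibbs' inequality with the product of the two marginals as weight; its total is
  1.\<close>

lemma rv_entropy_subadditive:
  assumes X: "simple_function M X" and Y: "simple_function M Y"
  shows "rv_entropy M (\<lambda>x. (X x, Y x)) \<le> rv_entropy M X + rv_entropy M Y"
proof -
  define P where "P v = prob {y \<in> space M. X y = v}" for v
  define Q where "Q v = prob {y \<in> space M. Y y = v}" for v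
  have fin: "finite (X ` space M)" "finite (Y ` space M)"
    using X Y by (auto dest: simple_functionD)
  have "P (X x) > 0 \<and> Q (Y x) > 0"
    if "prob {y \<in> space M. (X y, Y y) = (X x, Y x)} > 0" for x
  proof -
    have "prob {y \<in> space M. (X y, Y y) = (X x, Y x)} \<le> P (X x)"
      unfolding P_def using simple_function_sets[OF X] by (intro finite_measure_mono) auto
    moreover have "prob {y \<in> space M. (X y, Y y) = (X x, Y x)} \<le> Q (Y x)"
      unfolding Q_def using simple_function_sets[OF Y] by (intro finite_measure_mono) auto
    ultimately show ?thesis using that by linarith
  qed
  note pos = this
  have "(\<integral>x. ln ((\<lambda>(a, b). P a * Q b) (X x, Y x)) \<partial>M) + rv_entropy M (\<lambda>x. (X x, Y x))
      \<le> ln (\<Sum>v\<in>X ` space M \<times> Y ` space M. (\<lambda>(a, b). P a * Q b) v)"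
  proof (rule gibbs)
    show "simple_function M (\<lambda>x. (X x, Y x))" by (intro simple_function_pair X Y)
  qed (use fin pos in \<open>auto simp: P_def Q_def zero_less_mult_iff\<close>)
  also have "(\<Sum>v\<in>X ` space M \<times> Y ` space M. (\<lambda>(a, b). P a * Q b) v) =
      (\<Sum>a\<in>X ` space M. P a) * (\<Sum>b\<in>Y ` space M. Q b)"
    by (simp add: sum_product sum.cartesian_product)
  also have "\<dots> = 1" unfolding P_def Q_def using fin sum_prob_simple[OF X] sum_prob_simple[OF Y] by simp
  also have "(\<integral>x. ln ((\<lambda>(a, b). P a * Q b) (X x, Y x)) \<partial>M) = (\<integral>x. - info M X x + - info M Y x \<partial>M)"
  proof (rule integral_cong_AE)
    show "(\<lambda>x. ln ((\<lambda>(a, b). P a * Q b) (X x, Y x))) \<in> borel_measurable M"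
      by (intro borel_measurable_integrable integrable_simple_compose[OF simple_function_pair[OF X Y]])
    show "(\<lambda>x. - info M X x + - info M Y x) \<in> borel_measurable M"
      using integrable_info[OF X] integrable_info[OF Y] by auto
    show "AE x in M. ln ((\<lambda>(a, b). P a * Q b) (X x, Y x)) = - info M X x + - info M Y x"
      using AE_atom_pos[OF X] AE_atom_pos[OF Y]
      by eventually_elim (simp add: P_def Q_def info_def ln_mult)
  qed
  also have "\<dots> = - rv_entropy M X - rv_entropy M Y"
    unfolding rv_entropy_def by (simp add: integrable_info X Y)
  finally show ?thesis by simp
qed

text \<open>Gibbs' inequality with the marginal of \<open>X\<close> as weight, constant in the
  second coordinate, so that the total is \<open>card J\<close>. It serves to forget the offset
  within a block.\<close>

lemma rv_entropy_pair_card: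
  assumes X: "simple_function M X" and Y: "simple_function M Y" and J: "finite J" "Y ` space M \<subseteq> J"
  shows "rv_entropy M (\<lambda>x. (X x, Y x)) \<le> rv_entropy M X + ln (card J)"
proof -
  define P where "P v = prob {y \<in> space M. X y = v}" for v
  have fin: "finite (X ` space M)"
    using X by (auto dest: simple_functionD)
  have pos: "P (X x) > 0"
    if "prob {y \<in> space M. (X y, Y y) = (X x, Y x)} > 0" for x
  proof -
    have "prob {y \<in> space M. (X y, Y y) = (X x, Y x)} \<le> P (X x)"
      unfolding P_def using simple_function_sets[OF X] by (intro finite_measure_mono) auto
    then show ?thesis using that by linarith
  qed
  have "(\<integral>x. ln ((\<lambda>(a, b). P a) (X x, Y x)) \<partial>M) + rv_entropy M (\<lambda>x. (X x, Y x))
      \<le> ln (\<Sum>v\<in>X ` space M \<times> J. (\<lambda>(a, b). P a) v)"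
  proof (rule gibbs)
    show "simple_function M (\<lambda>x. (X x, Y x))" by (intro simple_function_pair X Y)
  qed (use fin pos J in \<open>auto simp: P_def\<close>)
  also have "(\<Sum>v\<in>X ` space M \<times> J. (\<lambda>(a, b). P a) v) = card J * (\<Sum>a\<in>X ` space M. P a)"
    by (simp add: sum.cartesian_product[symmetric] sum_distrib_left)
  also have "\<dots> = card J" unfolding P_def using fin sum_prob_simple[OF X] by simp
  also have "(\<integral>x. ln ((\<lambda>(a, b). P a) (X x, Y x)) \<partial>M) = - rv_entropy M X"
    unfolding rv_entropy_def info_def P_def by simp
  finally show ?thesis by simp
qed

end

lemma rv_entropy_distr:
  assumes g: "g \<in> measurable M N" and X: "simple_function N X"
  shows "rv_entropy (distr M N g) X = rv_entropy M (\<lambda>x. X (g x))"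
proof -
  have *: "measure (distr M N g) {y \<in> space N. X y = v} = measure M {x \<in> space M. X (g x) = v}" for v
  proof -
    have "g -` {y \<in> space N. X y = v} \<inter> space M = {x \<in> space M. X (g x) = v}"
      using measurable_space[OF g] by auto
    then show ?thesis using measure_distr[OF g simple_function_sets[OF X]] by simp
  qed
  have "info (distr M N g) X \<in> borel_measurable N"
    unfolding info_def
    using simple_function_compose1[OF X, of "\<lambda>v. - ln (measure (distr M N g) {y \<in> space (distr M N g). X y = v})"]
    by (rule borel_measurable_simple_function)
  then have "rv_entropy (distr M N g) X = (\<integral>x. info (distr M N g) X (g x) \<partial>M)"
    unfolding rv_entropy_def by (rule integral_distr[OF g])
  then show ?thesis by (simp add: rv_entropy_def info_def *)
qed

section \<open>Itineraries and iterated joins\<close>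

definition part_of :: "'a set set \<Rightarrow> 'a \<Rightarrow> 'a set" where
  "part_of P x = (THE A. A \<in> P \<and> x \<in> A)"

text \<open>The iterated join as a random variable. Restriction to \<open>{..<n}\<close> makes its
  values elements of a finite extensional function space.\<close>

definition itinerary :: "('a \<Rightarrow> 'a) \<Rightarrow> 'a set set \<Rightarrow> nat \<Rightarrow> 'a \<Rightarrow> nat \<Rightarrow> 'a set" where
  "itinerary f P n x = (\<lambda>i\<in>{..<n}. part_of P ((f ^^ i) x))"

lemma part_of_eq:
  assumes "partition_on S P" "A \<in> P" "x \<in> A"
  shows "part_of P x = A"
  unfolding part_of_def
  by (rule the_equality) (use assms in \<open>auto simp: partition_on_def disjoint_def\<close>)

lemma part_of_in:
  assumes "partition_on S P" "x \<in> S"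
  shows "part_of P x \<in> P" "x \<in> part_of P x"
proof -
  obtain A where "A \<in> P" "x \<in> A" using assms by (auto simp: partition_on_def)
  then show "part_of P x \<in> P" "x \<in> part_of P x" using part_of_eq[OF assms(1)] by auto
qed

lemma part_of_eq_iff:
  assumes "partition_on S P" "A \<in> P" "x \<in> S"
  shows "part_of P x = A \<longleftrightarrow> x \<in> A"
  using assms part_of_eq part_of_in by metis

lemma funpow_in_space:
  assumes "f \<in> measurable M M" "x \<in> space M"
  shows "(f ^^ i) x \<in> space M"
  by (induction i) (use assms measurable_space in auto)

lemma measurable_funpow:
  assumes "f \<in> measurable M M"
  shows "(f ^^ i) \<in> measurable M M"
proof (induction i)
  case (Suc i)
  then show ?case using assms measurable_comp by fastforce
qed (simp add: id_def)

lemma distr_funpow: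
  assumes "f \<in> measurable M M" "distr M M f = M"
  shows "distr M M (f ^^ i) = M"
proof (induction i)
  case 0
  then show ?case by (simp add: id_def distr_id)
next
  case (Suc i)
  have "distr M M (f ^^ Suc i) = distr (distr M M (f ^^ i)) M f"
    using distr_distr[OF assms(1) measurable_funpow[OF assms(1), of i]] by (simp only: funpow.simps)
  then show ?case using Suc assms by (simp only:)
qed

lemma simple_function_measurable_comp:
  assumes f: "f \<in> measurable M N" and X: "simple_function N X"
  shows "simple_function M (\<lambda>x. X (f x))"
  unfolding simple_function_def
proof (intro conjI ballI)
  note fs = measurable_space[OF f]
  have "(\<lambda>x. X (f x)) ` space M \<subseteq> X ` space N" using fs by auto
  then show "finite ((\<lambda>x. X (f x)) ` space M)"
    using simple_functionD(1)[OF X] finite_subset by blast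
  fix v
  have "(\<lambda>x. X (f x)) -` {v} \<inter> space M = f -` (X -` {v} \<inter> space N) \<inter> space M" using fs by auto
  then show "(\<lambda>x. X (f x)) -` {v} \<inter> space M \<in> sets M"
    using measurable_sets[OF f simple_functionD(2)[OF X]] by simp
qed

lemma simple_function_part_of:
  assumes P: "finite_measurable_partition M P" and f: "f \<in> measurable N M"
  shows "simple_function N (\<lambda>x. part_of P (f x))"
proof -
  have P': "finite P" "P \<subseteq> sets M" "partition_on (space M) P"
    using P by (auto simp: finite_measurable_partition_def)
  have fs: "f x \<in> space M" if "x \<in> space N" for x using that measurable_space[OF f] by auto
  show ?thesis unfolding simple_function_def
  proof (intro conjI ballI)
    have "(\<lambda>x. part_of P (f x)) ` space N \<subseteq> P" using part_of_in[OF P'(3)] fs by auto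
    then show "finite ((\<lambda>x. part_of P (f x)) ` space N)" using P'(1) finite_subset by blast
    fix A assume "A \<in> (\<lambda>x. part_of P (f x)) ` space N"
    then have A: "A \<in> P" using part_of_in[OF P'(3)] fs by auto
    have "(\<lambda>x. part_of P (f x)) -` {A} \<inter> space N = f -` A \<inter> space N"
      using part_of_eq_iff[OF P'(3) A] fs by auto
    then show "(\<lambda>x. part_of P (f x)) -` {A} \<inter> space N \<in> sets N"
      using measurable_sets[OF f] A P'(2) by auto
  qed
qed

lemma simple_function_restrict:
  assumes "finite I" "\<And>i. i \<in> I \<Longrightarrow> simple_function M (X i)"
  shows "simple_function M (\<lambda>x. \<lambda>i\<in>I. X i x)"
  using assms
proof (induction I rule: finite_induct)
  case empty
  then show ?case by simp
next
  case (insert i I)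
  have "simple_function M (\<lambda>x. (\<lambda>g a j. if j = i then a else g j) (\<lambda>j\<in>I. X j x) (X i x))"
    using insert by (intro simple_function_compose2[where h = "\<lambda>g a j. if j = i then a else g j"]) auto
  moreover have "(\<lambda>j\<in>insert i I. X j x) = (\<lambda>j. if j = i then X i x else (\<lambda>j\<in>I. X j x) j)" for x
    using insert(2) by (auto simp: restrict_def)
  ultimately show ?case by simp
qed

lemma simple_function_itinerary:
  assumes P: "finite_measurable_partition M P" and f: "f \<in> measurable M M"
  shows "simple_function M (itinerary f P n)"
  unfolding itinerary_def
  by (intro simple_function_restrict simple_function_part_of[OF P] measurable_funpow[OF f]) auto

lemma itinerary_in:
  assumes P: "finite_measurable_partition M P" and f: "f \<in> measurable M M" and x: "x \<in> space M"
  shows "itinerary f P n x \<in> {..<n} \<rightarrow>\<^sub>E P"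
proof -
  have P': "partition_on (space M) P"
    using P by (auto simp: finite_measurable_partition_def)
  show ?thesis
    by (auto simp: itinerary_def part_of_in(1)[OF P' funpow_in_space[OF f x]])
qed

text \<open>The elements of the join are the level sets of the itinerary, indexed by all conceivable
  itineraries, including those that no point follows.\<close>

lemma partition_entropy_iterated_join:
  assumes M: "prob_space M" and P: "finite_measurable_partition M P" and f: "f \<in> measurable M M"
  shows "partition_entropy M (iterated_join M f P n) = rv_entropy M (itinerary f P n)"
proof -
  have P': "finite P" "partition_on (space M) P"
    using P by (auto simp: finite_measurable_partition_def)
  define V where "V = ({..<n} \<rightarrow>\<^sub>E P)"
  have V: "finite V" "itinerary f P n ` space M \<subseteq> V"
    using itinerary_in[OF P f] P'(1) by (auto simp: V_def intro!: finite_PiE)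
  define h where "h v = {x \<in> space M. itinerary f P n x = v}" for v
  have atom: "h (restrict c {..<n}) = {x \<in> space M. \<forall>i<n. (f ^^ i) x \<in> c i}" if "\<forall>i<n. c i \<in> P" for c
  proof -
    have "itinerary f P n x = restrict c {..<n} \<longleftrightarrow> (\<forall>i<n. (f ^^ i) x \<in> c i)" if "x \<in> space M" for x
    proof -
      have "itinerary f P n x = restrict c {..<n} \<longleftrightarrow> (\<forall>i<n. part_of P ((f ^^ i) x) = c i)"
        by (auto simp: itinerary_def fun_eq_iff)
      then show ?thesis
        using part_of_eq_iff[OF P'(2) _ funpow_in_space[OF f that]] \<open>\<forall>i<n. c i \<in> P\<close> by auto
    qed
    then show ?thesis by (auto simp: h_def)
  qed
  have "iterated_join M f P n = h ` V"
  proof (intro equalityI subsetI)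
    fix A assume "A \<in> iterated_join M f P n"
    then obtain c where "A = {x \<in> space M. \<forall>i<n. (f ^^ i) x \<in> c i}" and c: "\<forall>i<n. c i \<in> P"
      by (auto simp: iterated_join_def)
    then have "A = h (restrict c {..<n})" using atom by simp
    moreover have "restrict c {..<n} \<in> V" using c by (auto simp: V_def)
    ultimately show "A \<in> h ` V" by blast
  next
    fix A assume "A \<in> h ` V"
    then obtain v where v: "v \<in> V" "A = h v" by auto
    then have "restrict v {..<n} = v" "\<forall>i<n. v i \<in> P" by (auto simp: V_def PiE_restrict)
    then show "A \<in> iterated_join M f P n"
      using atom[of v] v by (auto simp: iterated_join_def)
  qed
  then have "partition_entropy M (iterated_join M f P n) = - (\<Sum>A\<in>h ` V. measure M A * ln (measure M A))"
    by (simp add: partition_entropy_def)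
  also have "\<dots> = - (\<Sum>v\<in>V. measure M (h v) * ln (measure M (h v)))"
  proof (subst sum.reindex_nontrivial[OF V(1)])
    \<comment> \<open>Different itineraries can share a level set only if it is empty, and then it
      contributes 0 to the entropy.\<close>
    fix v w assume "v \<noteq> w" "h v = h w"
    then have "h v = {}" by (auto simp: h_def)
    then show "measure M (h v) * ln (measure M (h v)) = 0" by simp
  qed simp
  also have "\<dots> = rv_entropy M (itinerary f P n)"
    unfolding h_def
    using prob_space.rv_entropy_eq_sum[OF M simple_function_itinerary[OF P f] V] by simp
  finally show ?thesis .
qed

text \<open>An itinerary of length \<open>n + m\<close> amounts to one of length \<open>n\<close>
  and one of length \<open>m\<close> started at \<open>(f ^^ n) x\<close>, a point with the same law
  as \<open>x\<close>.\<close>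

lemma rv_entropy_itinerary_subadditive:
  assumes M: "prob_space M" and P: "finite_measurable_partition M P" and f: "f \<in> measurable M M"
    and inv: "distr M M f = M"
  shows "rv_entropy M (itinerary f P (n + m)) \<le>
    rv_entropy M (itinerary f P n) + rv_entropy M (itinerary f P m)"
proof -
  interpret prob_space M by fact
  note f' = measurable_funpow[OF f]
  have shift: "itinerary f P (n + m) x = itinerary f P (n + m) y \<longleftrightarrow>
      (itinerary f P n x, itinerary f P m ((f ^^ n) x)) = (itinerary f P n y, itinerary f P m ((f ^^ n) y))"
    for x y
  proof -
    have "itinerary f P (n + m) x = itinerary f P (n + m) y \<longleftrightarrow>
        (\<forall>i<n + m. part_of P ((f ^^ i) x) = part_of P ((f ^^ i) y))"
      by (auto simp: itinerary_def fun_eq_iff)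
    also have "\<dots> \<longleftrightarrow> (\<forall>i<n. part_of P ((f ^^ i) x) = part_of P ((f ^^ i) y)) \<and>
        (\<forall>i<m. part_of P ((f ^^ (i + n)) x) = part_of P ((f ^^ (i + n)) y))"
      (is "?l \<longleftrightarrow> ?r")
    proof
      assume ?r
      show ?l
      proof (intro allI impI)
        fix i assume "i < n + m"
        then show "part_of P ((f ^^ i) x) = part_of P ((f ^^ i) y)"
          using conjunct1[OF \<open>?r\<close>, rule_format, of i] conjunct2[OF \<open>?r\<close>, rule_format, of "i - n"]
          by (cases "i < n") auto
      qed
    qed auto
    also have "\<dots> \<longleftrightarrow> (itinerary f P n x, itinerary f P m ((f ^^ n) x)) =
        (itinerary f P n y, itinerary f P m ((f ^^ n) y))"
      by (auto simp: itinerary_def fun_eq_iff funpow_add)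
    finally show ?thesis .
  qed
  have "rv_entropy M (itinerary f P (n + m)) =
      rv_entropy M (\<lambda>x. (itinerary f P n x, itinerary f P m ((f ^^ n) x)))"
    by (rule rv_entropy_cong) (rule shift)
  also have "\<dots> \<le> rv_entropy M (itinerary f P n) + rv_entropy M (\<lambda>x. itinerary f P m ((f ^^ n) x))"
    using simple_function_itinerary[OF P f]
    by (intro rv_entropy_subadditive simple_function_measurable_comp[OF f']) auto
  also have "rv_entropy M (\<lambda>x. itinerary f P m ((f ^^ n) x)) = rv_entropy M (itinerary f P m)"
    using rv_entropy_distr[OF f' simple_function_itinerary[OF P f], of n]
    by (simp add: distr_funpow[OF f inv])
  finally show ?thesis by simp
qed

section \<open>Fekete's lemma\<close>

text \<open>Dividing \<open>n\<close> by a fixed \<open>k\<close> with remainder gives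
  \<open>a n / n\<close> at least \<open>a k / k\<close> up to a bounded error over
  \<open>n\<close>. Stated in \<open>ereal\<close> because the supremum may be infinite.\<close>

lemma superadditive_LIMSEQ:
  fixes a :: "nat \<Rightarrow> real"
  assumes super: "\<And>n m. n \<ge> 1 \<Longrightarrow> m \<ge> 1 \<Longrightarrow> a n + a m \<le> a (n + m)"
  shows "(\<lambda>n. ereal (a n / real n)) \<longlonglongrightarrow> (SUP n\<in>{1..}. ereal (a n / real n))"
proof (rule order_tendstoI)
  fix u assume u: "(SUP n\<in>{1..}. ereal (a n / real n)) < u"
  have "ereal (a n / real n) \<le> (SUP n\<in>{1..}. ereal (a n / real n))" if "n \<ge> 1" for n
    using that by (intro SUP_upper) auto
  then show "\<forall>\<^sub>F n in sequentially. ereal (a n / real n) < u"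
    using u by (intro eventually_sequentiallyI[of 1]) (metis order.strict_trans1)
next
  fix l assume "l < (SUP n\<in>{1..}. ereal (a n / real n))"
  then obtain k where k: "k \<ge> 1" "l < ereal (a k / real k)"
    by (auto simp: less_SUP_iff)
  define c where "c = a k / real k"
  obtain d where d: "l < ereal d" "d < c" using ereal_dense2[OF k(2)] by (auto simp: c_def)
  define b where "b = Min (insert 0 (a ` {..<k}))"
  have b: "b \<le> 0" "\<And>r. r < k \<Longrightarrow> b \<le> a r" by (auto simp: b_def)
  \<comment> \<open>A remainder 0 contributes 0 rather than \<open>a 0\<close>, about which nothing
    is assumed; hence also the 0 inserted into the minimum \<open>b\<close>.\<close>
  have super': "real t * a k + (if r = 0 then 0 else a r) \<le> a (t * k + r)" if "t * k + r \<ge> 1" for t r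
    using that
  proof (induction t)
    case (Suc t)
    show ?case
    proof (cases "t * k + r \<ge> 1")
      case True
      have "a k + a (t * k + r) \<le> a (k + (t * k + r))" using True k(1) by (intro super) auto
      then show ?thesis using Suc.IH[OF True] by (simp add: algebra_simps)
    next
      case False
      then have "t * k = 0" "r = 0" by linarith+
      then have "t = 0" "r = 0" using k(1) by auto
      then show ?thesis by simp
    qed
  qed auto
  have lower: "real n * c - real k * \<bar>c\<bar> + b \<le> a n" if n: "n \<ge> 1" for n
  proof -
    have "real (n div k) * a k + (if n mod k = 0 then 0 else a (n mod k)) \<le> a n"
      using super'[of "n div k" "n mod k"] n by simp
    moreover have "b \<le> (if n mod k = 0 then 0 else a (n mod k))"
      using b k by auto
    moreover have "real (n div k) * a k = (real n - real (n mod k)) * c"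
    proof -
      have "real n = real (n div k) * real k + real (n mod k)"
        by (metis div_mult_mod_eq of_nat_add of_nat_mult)
      then show ?thesis using k by (simp add: c_def)
    qed
    moreover have "real (n mod k) * c \<le> real k * \<bar>c\<bar>"
    proof -
      have "real (n mod k) * c \<le> real (n mod k) * \<bar>c\<bar>" by (intro mult_left_mono) auto
      also have "\<dots> \<le> real k * \<bar>c\<bar>" using k by (intro mult_right_mono) auto
      finally show ?thesis .
    qed
    ultimately show ?thesis by (simp add: algebra_simps)
  qed
  \<comment> \<open>Beyond \<open>N\<close> the gain \<open>n * (c - d)\<close> exceeds the bounded
    error of \<open>lower\<close>.\<close>
  obtain N :: nat where N: "real N > (real k * \<bar>c\<bar> - b) / (c - d)" using reals_Archimedean2 by blast
  show "\<forall>\<^sub>F n in sequentially. l < ereal (a n / real n)"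
  proof (rule eventually_sequentiallyI[of "max 1 N"])
    fix n assume n: "max 1 N \<le> n"
    then have "(real k * \<bar>c\<bar> - b) / (c - d) < real n" using N by linarith
    then have "real k * \<bar>c\<bar> - b < real n * (c - d)" using d by (simp add: field_simps)
    then have "real n * d < a n" using lower[of n] n by (simp add: algebra_simps)
    then have "d < a n / real n" using n by (simp add: field_simps)
    then show "l < ereal (a n / real n)" using d(1) by (meson ereal_less(2) less_ereal.simps(1) less_trans)
  qed
qed

text \<open>Fekete's lemma for the negated entropies. It turns the \<open>lim\<close> in the
  definition of \<open>entropy_wrt_partition\<close> into a genuine limit.\<close>

lemma entropy_wrt_partition_LIMSEQ:
  assumes M: "prob_space M" and P: "finite_measurable_partition M P" and f: "f \<in> measurable M M"
    and inv: "distr M M f = M"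
  shows "(\<lambda>n. ereal (rv_entropy M (itinerary f P n) / real n)) \<longlonglongrightarrow> entropy_wrt_partition M f P"
proof -
  have "(\<lambda>n. ereal (- rv_entropy M (itinerary f P n) / real n)) \<longlonglongrightarrow>
      (SUP n\<in>{1..}. ereal (- rv_entropy M (itinerary f P n) / real n))"
  proof (rule superadditive_LIMSEQ)
    fix n m
    show "- rv_entropy M (itinerary f P n) + - rv_entropy M (itinerary f P m) \<le>
        - rv_entropy M (itinerary f P (n + m))"
      using rv_entropy_itinerary_subadditive[OF M P f inv, of n m] by linarith
  qed
  then have "(\<lambda>n. - ereal (- rv_entropy M (itinerary f P n) / real n)) \<longlonglongrightarrow>
      - (SUP n\<in>{1..}. ereal (- rv_entropy M (itinerary f P n) / real n))"
    by (rule tendsto_uminus_ereal)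
  then have "(\<lambda>n. ereal (rv_entropy M (itinerary f P n) / real n)) \<longlonglongrightarrow>
      - (SUP n\<in>{1..}. ereal (- rv_entropy M (itinerary f P n) / real n))"
    by simp
  then show ?thesis
    unfolding entropy_wrt_partition_def partition_entropy_iterated_join[OF M P f]
    by (simp add: limI)
qed

lemma entropy_wrt_partition_nonneg:
  assumes M: "prob_space M" and P: "finite_measurable_partition M P" and f: "f \<in> measurable M M"
    and inv: "distr M M f = M"
  shows "0 \<le> entropy_wrt_partition M f P"
  using prob_space.rv_entropy_nonneg[OF M]
  by (intro LIMSEQ_le_const[OF entropy_wrt_partition_LIMSEQ[OF M P f inv]])
    (auto intro!: exI[of _ 0] divide_nonneg_nonneg)

section \<open>Subshifts\<close>

definition word :: "nat \<Rightarrow> (nat \<Rightarrow> 'a) \<Rightarrow> 'a list" where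
  "word n x = map x [0..<n]"

lemma length_word [simp]: "length (word n x) = n"
  by (simp add: word_def)

lemma nth_word [simp]: "i < n \<Longrightarrow> word n x ! i = x i"
  by (simp add: word_def)

lemma word_eq_iff: "word n x = word n y \<longleftrightarrow> (\<forall>i<n. x i = y i)"
  by (auto simp: list_eq_iff_nth_eq)

lemma funpow_shift: "(shift ^^ n) x = (\<lambda>i. x (i + n))"
proof (induction n)
  case (Suc n)
  then show ?case by (simp add: shift_def)
qed simp

lemma funpow_shift_in_subshift: "x \<in> subshift T \<Longrightarrow> (shift ^^ n) x \<in> subshift T"
  by (simp add: funpow_shift subshift_def)

lemma shift_in_subshift: "x \<in> subshift T \<Longrightarrow> shift x \<in> subshift T"
  using funpow_shift_in_subshift[of x T 1] by simp

lemma word_admissible: "x \<in> subshift T \<Longrightarrow> word n x \<in> admissible_words T n"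
  by (auto simp: word_def admissible_words_def subshift_def)

lemma in_cylinder_iff: "x \<in> cylinder T w \<longleftrightarrow> x \<in> subshift T \<and> word (length w) x = w"
  by (auto simp: cylinder_def list_eq_iff_nth_eq)

lemma finite_admissible_words: "finite (admissible_words T n)"
proof (rule finite_subset)
  show "admissible_words T n \<subseteq> {w. set w \<subseteq> {..<dim_row T} \<and> length w = n}"
    by (auto simp: admissible_words_def)
  show "finite {w. set w \<subseteq> {..<dim_row T} \<and> length w = n}"
    by (rule finite_lists_length_eq) simp
qed

lemma continuous_on_coord: "continuous_on S (\<lambda>x::nat \<Rightarrow> nat. x i)"
  by (rule continuous_on_subset[OF continuous_on_product_coordinates]) auto

lemma continuous_on_shift: "continuous_on S (shift :: (nat \<Rightarrow> nat) \<Rightarrow> _)"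
  unfolding shift_def by (intro continuous_on_coordinatewise_then_product continuous_on_coord)

lemma compact_subshift: "compact (subshift T)"
proof -
  let ?Q = "PiE UNIV (\<lambda>_::nat. {..<dim_row T})"
  have "compactin (product_topology (\<lambda>_::nat. euclidean) UNIV) ?Q"
    by (subst compactin_PiE) (auto intro: finite_imp_compact)
  then have "compact ?Q" by (simp add: euclidean_product_topology)
  moreover have "closed (subshift T)"
  proof -
    have "closed {x::nat \<Rightarrow> nat. (x i, x (Suc i)) \<in> R}" for i R
    proof -
      have "open ((\<lambda>x::nat \<Rightarrow> nat. x i) -` {a})" for i and a :: nat
        by (intro open_vimage discrete_topology_class.open_discrete continuous_on_coord)
      then have "open (\<Union>(a, b)\<in>-R. (\<lambda>x::nat \<Rightarrow> nat. x i) -` {a} \<inter> (\<lambda>x. x (Suc i)) -` {b})"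
        by (intro open_UN) (auto intro: open_Int)
      also have "(\<Union>(a, b)\<in>-R. (\<lambda>x::nat \<Rightarrow> nat. x i) -` {a} \<inter> (\<lambda>x. x (Suc i)) -` {b}) =
          - {x. (x i, x (Suc i)) \<in> R}" by auto
      finally show ?thesis by (simp add: closed_def)
    qed
    then have "closed (\<Inter>i. {x::nat \<Rightarrow> nat. (x i, x (Suc i)) \<in> {(a, b). a < dim_row T \<and> T $$ (a, b) = 1}})"
      by (intro closed_INT) blast
    also have "\<dots> = subshift T" by (auto simp: subshift_def)
    finally show ?thesis .
  qed
  ultimately have "compact (?Q \<inter> subshift T)" by (rule compact_Int_closed)
  moreover have "?Q \<inter> subshift T = subshift T" by (auto simp: subshift_def)
  ultimately show ?thesis by simp
qed

text \<open>Compactness of the subshift makes \<open>f\<close> uniformly continuous, and sharing a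
  long initial word means being close.\<close>

lemma uniformly_continuous_cylinder:
  fixes f :: "(nat \<Rightarrow> nat) \<Rightarrow> real"
  assumes f: "continuous_on (subshift T) f" and e: "e > 0"
  obtains L where "\<And>x y. x \<in> subshift T \<Longrightarrow> y \<in> subshift T \<Longrightarrow> word L x = word L y \<Longrightarrow> \<bar>f x - f y\<bar> < e"
proof -
  \<comment> \<open>\<open>nat\<close> is not an instance of \<open>metric_space\<close>, so the subshift is embedded into real sequences.\<close>
  define emb :: "(nat \<Rightarrow> nat) \<Rightarrow> nat \<Rightarrow> real" where "emb x = (\<lambda>i. real (x i))" for x
  define ret :: "(nat \<Rightarrow> real) \<Rightarrow> nat \<Rightarrow> nat" where "ret y = (\<lambda>i. nat \<lfloor>y i\<rfloor>)" for y
  have inv: "ret (emb x) = x" for x by (simp add: emb_def ret_def)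
  have emb: "continuous_on (subshift T) emb"
    unfolding emb_def by (intro continuous_on_coordinatewise_then_product
        continuous_on_compose2[OF _ continuous_on_coord[where S = "subshift T"], of UNIV])
      (auto intro: continuous_on_discrete)
  have ret: "continuous_on (emb ` subshift T) ret"
    using emb compact_subshift inv by (intro continuous_on_inv) auto
  have "continuous_on (emb ` subshift T) (\<lambda>y. f (ret y))"
    by (rule continuous_on_compose2[OF f ret]) (auto simp: inv)
  moreover have "compact (emb ` subshift T)"
    using emb compact_subshift by (rule compact_continuous_image)
  ultimately have "uniformly_continuous_on (emb ` subshift T) (\<lambda>y. f (ret y))"
    by (rule compact_uniformly_continuous)
  then obtain d where d: "d > 0"
    "\<And>x y. x \<in> subshift T \<Longrightarrow> y \<in> subshift T \<Longrightarrow> dist (emb x) (emb y) < d \<Longrightarrow> dist (f x) (f y) < e"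
    unfolding uniformly_continuous_on_def using e by (metis imageI inv)
  obtain N where N: "(1 / 2) ^ N < d"
    using real_arch_pow_inv[of d "1/2"] d by auto
  \<comment> \<open>The metric on sequences enumerates coordinates by \<open>from_nat\<close>, so
    the common word must reach all coordinates \<open>from_nat 0\<close>, ...,
    \<open>from_nat N\<close>.\<close>
  define L where "L = Suc (Max (from_nat ` {..N}))"
  show thesis
  proof (rule that[of L])
    fix x y assume xy: "x \<in> subshift T" "y \<in> subshift T" "word L x = word L y"
    have *: "from_nat n < L" if "n \<le> N" for n
      unfolding L_def using that by (auto intro!: le_imp_less_Suc Max_ge)
    have "{dist (emb x (from_nat n)) (emb y (from_nat n)) |n. n \<le> N} = {0}"
      using xy(3) * by (force simp: word_eq_iff emb_def)
    then have "dist (emb x) (emb y) \<le> (1 / 2) ^ N"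
      using dist_fun_le_dist_first_terms[of "emb x" "emb y" N] by simp
    then have "dist (emb x) (emb y) < d" using N by simp
    then show "\<bar>f x - f y\<bar> < e" using d(2) xy by (simp add: dist_real_def)
  qed
qed

lemma bounded_on_subshift:
  fixes f :: "(nat \<Rightarrow> nat) \<Rightarrow> real"
  assumes "continuous_on (subshift T) f"
  obtains B where "B \<ge> 0" "\<And>x. x \<in> subshift T \<Longrightarrow> \<bar>f x\<bar> \<le> B"
proof -
  have "bounded (f ` subshift T)"
    using assms compact_subshift by (intro compact_imp_bounded compact_continuous_image)
  then obtain B where "\<forall>y\<in>f ` subshift T. norm y \<le> B" by (auto simp: bounded_iff)
  then show thesis by (intro that[of "max B 0"]) force+
qed

text \<open>Continuity makes the infimum over a cylinder a genuine one rather than a junk value of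
  \<open>Inf\<close> on the reals.\<close>

lemma bdd_below_cylinder:
  fixes f :: "(nat \<Rightarrow> nat) \<Rightarrow> real"
  assumes "continuous_on (subshift T) f"
  shows "bdd_below (f ` cylinder T w)"
proof -
  obtain B where "\<And>x. x \<in> subshift T \<Longrightarrow> \<bar>f x\<bar> \<le> B" using bounded_on_subshift[OF assms] by metis
  then show ?thesis by (intro bdd_belowI2[of _ "-B"]) (force simp: cylinder_def)
qed

section \<open>Measures on the subshift\<close>

abbreviation borel_subshift :: "nat mat \<Rightarrow> (nat \<Rightarrow> nat) measure" where
  "borel_subshift T \<equiv> restrict_space borel (subshift T)"

lemma space_borel_subshift [simp]: "space (borel_subshift T) = subshift T"
  by (simp add: space_restrict_space)

lemma measurable_shift: "shift \<in> measurable (borel_subshift T) (borel_subshift T)"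
proof (rule measurable_restrict_space2)
  show "shift \<in> measurable (borel_subshift T) borel"
    by (rule borel_measurable_continuous_on_restrict[OF continuous_on_shift])
qed (auto intro: shift_in_subshift)

lemma simple_function_word:
  assumes sets: "sets M = sets (borel_subshift T)"
  shows "simple_function M (word k)"
  unfolding simple_function_def
proof (intro conjI ballI)
  have space: "space M = subshift T" using sets_eq_imp_space_eq[OF sets] by simp
  have "word k ` space M \<subseteq> admissible_words T k" using word_admissible space by auto
  then show "finite (word k ` space M)" using finite_admissible_words finite_subset by blast
  fix v :: "nat list" assume "v \<in> word k ` space M"
  then have len: "length v = k" by auto
  have "(\<lambda>x. x i) \<in> measurable M borel" for i
    using borel_measurable_continuous_on_restrict[OF continuous_on_coord[of "subshift T" i]]
    by (simp add: measurable_cong_sets[OF sets refl])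
  then have "(\<lambda>x. x i) -` {a} \<inter> space M \<in> sets M" for i a
    by (rule measurable_sets) auto
  then have "space M \<inter> (\<Inter>i\<in>{..<k}. (\<lambda>x. x i) -` {v ! i} \<inter> space M) \<in> sets M"
    by (cases "k = 0") (auto simp del: INT_simps intro!: sets.finite_INT sets.Int)
  also have "space M \<inter> (\<Inter>i\<in>{..<k}. (\<lambda>x. x i) -` {v ! i} \<inter> space M) = word k -` {v} \<inter> space M"
    using len by (auto simp: list_eq_iff_nth_eq)
  finally show "word k -` {v} \<inter> space M \<in> sets M" .
qed

section \<open>Approximation of measurable sets by unions of cylinders\<close>

definition determined :: "nat mat \<Rightarrow> nat \<Rightarrow> (nat \<Rightarrow> nat) set \<Rightarrow> bool" where
  "determined T k A \<longleftrightarrow>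
     (\<forall>x\<in>subshift T. \<forall>y\<in>subshift T. word k x = word k y \<longrightarrow> x \<in> A \<longrightarrow> y \<in> A)"

lemma determined_mono: "determined T k A \<Longrightarrow> k \<le> l \<Longrightarrow> determined T l A"
  unfolding determined_def word_eq_iff by (meson less_le_trans)

text \<open>The sets that can be approximated by unions of cylinders contain the coordinate events
  and are closed under complement and countable union. The induction runs over Borel sets
  \<open>B\<close> of the full space, since \<open>A\<close> is only the trace of such a
  set.\<close>

lemma measurable_approx_determined:
  assumes M: "prob_space M" and sets: "sets M = sets (borel_subshift T)"
    and A: "A \<in> sets M" and e: "e > 0"
  shows "\<exists>k C. C \<in> sets M \<and> determined T k C \<and> measure M (sym_diff A C) < e"
proof -
  interpret prob_space M by fact
  have space: "space M = subshift T" using sets_eq_imp_space_eq[OF sets] by simp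
  have borel: "sets (borel :: (nat \<Rightarrow> nat) measure) =
      sigma_sets (UNIV \<rightarrow>\<^sub>E UNIV) {{f\<in>UNIV \<rightarrow>\<^sub>E UNIV. f i \<in> A} | i A. A \<in> sets (borel :: nat measure)}"
    using sets_PiM_single[of UNIV "\<lambda>_::nat. borel :: nat measure"]
    by (simp add: sets_PiM_equal_borel)
  have inM: "subshift T \<inter> B \<in> sets M" if "B \<in> sets borel" for B
    using that unfolding sets sets_restrict_space by blast
  obtain B where B: "B \<in> sets borel" "A = subshift T \<inter> B"
    using A unfolding sets sets_restrict_space by auto
  have "\<exists>k C. C \<in> sets M \<and> determined T k C \<and> measure M (sym_diff (subshift T \<inter> B) C) < e"
    using B(1) e unfolding borel
  proof (induction B arbitrary: e rule: sigma_sets.induct)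
    case (Basic B)
    then obtain i S where S: "B = {f\<in>UNIV \<rightarrow>\<^sub>E UNIV. f i \<in> S}" "S \<in> sets (borel :: nat measure)" by auto
    have "B \<in> sets borel" unfolding borel using Basic by (intro sigma_sets.Basic) auto
    moreover have "determined T (Suc i) (subshift T \<inter> B)"
      by (auto simp: determined_def word_eq_iff S)
    ultimately show ?case using inM \<open>e > 0\<close>
      by (intro exI[of _ "Suc i"] exI[of _ "subshift T \<inter> B"]) auto
  next
    case Empty
    then show ?case by (intro exI[of _ 0] exI[of _ "{}"]) (auto simp: determined_def)
  next
    case (Compl B)
    then obtain k C where C: "C \<in> sets M" "determined T k C" "measure M (sym_diff (subshift T \<inter> B) C) < e" by blast
    have "C \<subseteq> subshift T" using sets.sets_into_space[OF C(1)] space by simp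
    then have "sym_diff (subshift T \<inter> ((UNIV \<rightarrow>\<^sub>E UNIV) - B)) (space M - C) = sym_diff (subshift T \<inter> B) C"
      by (auto simp: space)
    moreover have "determined T k (space M - C)"
      using C(2) unfolding determined_def space by (metis DiffD2 DiffI)
    ultimately show ?case using C by (intro exI[of _ k] exI[of _ "space M - C"]) auto
  next
    case (Union a)
    define D where "D n = subshift T \<inter> (\<Union>i<n. a i)" for n
    have a: "a i \<in> sets borel" for i unfolding borel using Union.hyps by auto
    then have D: "D n \<in> sets M" for n unfolding D_def by (intro inM) auto
    have Un: "(\<Union>n. D n) = subshift T \<inter> (\<Union>i. a i)" unfolding D_def by auto
    have "(\<lambda>n. measure M (D n)) \<longlonglongrightarrow> measure M (\<Union>n. D n)"
      using D by (intro finite_Lim_measure_incseq) (auto simp: D_def incseq_def, blast intro: less_le_trans)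
    then have "\<exists>n. dist (measure M (D n)) (measure M (\<Union>n. D n)) < e / 2"
      using \<open>e > 0\<close> by (meson half_gt_zero lim_sequentially order_refl)
    then obtain n where n: "\<bar>measure M (D n) - measure M (\<Union>n. D n)\<bar> < e / 2"
      by (auto simp: dist_real_def)
    \<comment> \<open>Half of \<open>e\<close> pays for cutting the union at \<open>n\<close>, the
      other half for \<open>n\<close> approximations; \<open>real n + 1\<close> covers
      \<open>n = 0\<close>.\<close>
    have "\<forall>i. \<exists>k C. C \<in> sets M \<and> determined T k C \<and> measure M (sym_diff (subshift T \<inter> a i) C) < e / (2 * (real n + 1))"
      using Union.IH \<open>e > 0\<close> by (simp add: zero_less_divide_iff)
    then obtain k C where C: "\<And>i. C i \<in> sets M" "\<And>i. determined T (k i) (C i)"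
      "\<And>i. measure M (sym_diff (subshift T \<inter> a i) (C i)) < e / (2 * (real n + 1))"
      by metis
    define l where "l = Max (k ` {..<n})"
    have "determined T l (C i)" if "i < n" for i
      using C(2) by (rule determined_mono) (use that in \<open>auto simp: l_def\<close>)
    then have det: "determined T l (\<Union>i<n. C i)"
      unfolding determined_def by blast
    have a': "subshift T \<inter> a i \<in> sets M" for i using a inM by auto
    have sub: "sym_diff (subshift T \<inter> (\<Union>i. a i)) (\<Union>i<n. C i) \<subseteq>
        ((\<Union>n. D n) - D n) \<union> (\<Union>i<n. sym_diff (subshift T \<inter> a i) (C i))"
      unfolding D_def by auto
    have "measure M (sym_diff (subshift T \<inter> (\<Union>i. a i)) (\<Union>i<n. C i)) \<le>
        measure M (((\<Union>n. D n) - D n) \<union> (\<Union>i<n. sym_diff (subshift T \<inter> a i) (C i)))"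
      using sub D C(1) a' by (intro finite_measure_mono) auto
    also have "\<dots> \<le> measure M ((\<Union>n. D n) - D n) + measure M (\<Union>i<n. sym_diff (subshift T \<inter> a i) (C i))"
      using D C(1) a' by (intro measure_Un_le) auto
    also have "measure M ((\<Union>n. D n) - D n) = measure M (\<Union>n. D n) - measure M (D n)"
      using D by (intro finite_measure_Diff) auto
    also have "\<dots> < e / 2" using n by linarith
    also have "measure M (\<Union>i<n. sym_diff (subshift T \<inter> a i) (C i)) \<le>
        (\<Sum>i<n. measure M (sym_diff (subshift T \<inter> a i) (C i)))"
      using C(1) a' by (intro finite_measure_subadditive_finite) auto
    also have "\<dots> \<le> (\<Sum>i<n. e / (2 * (real n + 1)))"
      using C(3) by (intro sum_mono less_imp_le)
    also have "\<dots> \<le> e / 2" using \<open>e > 0\<close> by (simp add: field_simps)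
    finally have "measure M (sym_diff (subshift T \<inter> (\<Union>i. a i)) (\<Union>i<n. C i)) < e" by simp
    then show ?case using det C(1)
      by (intro exI[of _ l] exI[of _ "\<Union>i<n. C i"]) auto
  qed
  then show ?thesis using B(2) by simp
qed

text \<open>Replace each partition element by a nearby union of cylinders \<open>C A\<close>. Off
  the union of the errors a point lies in \<open>A\<close> exactly when it lies in
  \<open>C A\<close>, which its first \<open>k\<close> letters decide.\<close>

lemma partition_approx_word:
  assumes M: "prob_space M" and sets: "sets M = sets (borel_subshift T)"
    and P: "finite_measurable_partition M P" and e: "e > 0"
  obtains k g where "measure M {x \<in> space M. part_of P x \<noteq> g (word k x)} < e"
proof -
  interpret prob_space M by fact
  have space: "space M = subshift T" using sets_eq_imp_space_eq[OF sets] by simp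
  have P': "finite P" "P \<subseteq> sets M" "partition_on (space M) P"
    using P by (auto simp: finite_measurable_partition_def)
  \<comment> \<open>The extra 1 makes the total of \<open>card P\<close> errors strictly less than
    \<open>e\<close>.\<close>
  define d where "d = e / (real (card P) + 1)"
  have "d > 0" using e by (simp add: d_def)
  then have "\<forall>A\<in>P. \<exists>k C. C \<in> sets M \<and> determined T k C \<and> measure M (sym_diff A C) < d"
    using measurable_approx_determined[OF M sets] P'(2) by blast
  then obtain l C where C: "\<And>A. A \<in> P \<Longrightarrow> C A \<in> sets M" "\<And>A. A \<in> P \<Longrightarrow> determined T (l A) (C A)"
    "\<And>A. A \<in> P \<Longrightarrow> measure M (sym_diff A (C A)) < d"
    by metis
  define k where "k = Max (l ` P)"
  have det: "determined T k (C A)" if "A \<in> P" for A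
    using C(2)[OF that] by (rule determined_mono) (use that P' in \<open>auto simp: k_def\<close>)
  \<comment> \<open>For a good point, any admissible choice is the right one: \<open>C A\<close> is
    a union of cylinders, so it contains the point itself as soon as it meets its cylinder.\<close>
  define g where "g u = (SOME A. A \<in> P \<and> (\<exists>x\<in>C A. word k x = u))" for u
  define N where "N = (\<Union>A\<in>P. sym_diff A (C A))"
  have N: "N \<in> sets M" unfolding N_def using C(1) P' by (intro sets.finite_UN sets.Un sets.Diff) auto
  have good: "g (word k x) = part_of P x" if x: "x \<in> space M" "x \<notin> N" for x
  proof -
    have iff: "x \<in> C A \<longleftrightarrow> x \<in> A" if "A \<in> P" for A using x that by (auto simp: N_def)
    note px = part_of_in[OF P'(3) x(1)]
    have "\<exists>A. A \<in> P \<and> (\<exists>y\<in>C A. word k y = word k x)" using px iff by blast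
    then have "g (word k x) \<in> P \<and> (\<exists>y\<in>C (g (word k x)). word k y = word k x)"
      unfolding g_def by (rule someI_ex)
    then obtain y where y: "g (word k x) \<in> P" "y \<in> C (g (word k x))" "word k y = word k x" by blast
    have "y \<in> subshift T" using C(1) y sets.sets_into_space space by blast
    then have "x \<in> C (g (word k x))"
      using det[OF y(1)] y x(1) space unfolding determined_def by blast
    then show ?thesis using iff[OF y(1)] part_of_eq[OF P'(3) y(1)] by auto
  qed
  have "measure M {x \<in> space M. part_of P x \<noteq> g (word k x)} \<le> measure M N"
    using good N by (intro finite_measure_mono) auto
  also have "\<dots> \<le> (\<Sum>A\<in>P. measure M (sym_diff A (C A)))"
    unfolding N_def using C(1) P' by (intro finite_measure_subadditive_finite) auto
  also have "\<dots> \<le> (\<Sum>A\<in>P. d)" using C(3) by (intro sum_mono less_imp_le)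
  also have "\<dots> < e" using e by (simp add: d_def field_simps)
  finally show thesis by (rule that)
qed

lemma invariant_measuresD:
  assumes "\<mu> \<in> invariant_measures T"
  shows "prob_space \<mu>" "sets \<mu> = sets (borel_subshift T)" "space \<mu> = subshift T"
    "shift \<in> measurable \<mu> \<mu>" "distr \<mu> \<mu> shift = \<mu>"
proof -
  show *: "prob_space \<mu>" "sets \<mu> = sets (borel_subshift T)" "distr \<mu> \<mu> shift = \<mu>"
    using assms by (auto simp: invariant_measures_def)
  show "space \<mu> = subshift T" using sets_eq_imp_space_eq[OF *(2)] by simp
  show "shift \<in> measurable \<mu> \<mu>"
    using measurable_shift by (simp add: measurable_cong_sets[OF *(2) *(2)])
qed

lemma integral_funpow_shift:
  fixes f :: "(nat \<Rightarrow> nat) \<Rightarrow> real"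
  assumes \<mu>: "\<mu> \<in> invariant_measures T" and f: "f \<in> borel_measurable \<mu>"
  shows "(\<integral>x. f ((shift ^^ n) x) \<partial>\<mu>) = (\<integral>x. f x \<partial>\<mu>)"
  using integral_distr[OF measurable_funpow[OF invariant_measuresD(4)[OF \<mu>], of n] f]
  by (simp add: distr_funpow[OF invariant_measuresD(4,5)[OF \<mu>]])

lemma continuous_integrable:
  fixes f :: "(nat \<Rightarrow> nat) \<Rightarrow> real"
  assumes M: "finite_measure M" and sets: "sets M = sets (borel_subshift T)"
    and f: "continuous_on (subshift T) f"
  shows "integrable M f"
proof -
  obtain B where "\<And>x. x \<in> subshift T \<Longrightarrow> \<bar>f x\<bar> \<le> B" using bounded_on_subshift[OF f] by metis
  moreover have "f \<in> borel_measurable M"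
    using borel_measurable_continuous_on_restrict[OF f] by (simp add: measurable_cong_sets[OF sets refl])
  ultimately show ?thesis
    using sets_eq_imp_space_eq[OF sets]
    by (intro finite_measure.integrable_const_bound[OF M, of _ B]) auto
qed

text \<open>Setting \<open>\<Phi> 0 = 0\<close> does not affect the pressures, whose \<open>0\<close>th terms are divided by zero.\<close>

locale superadditive_potential =
  fixes T :: "nat mat" and \<Phi> :: "nat \<Rightarrow> (nat \<Rightarrow> nat) \<Rightarrow> real"
  assumes continuous: "continuous_on (subshift T) (\<Phi> n)"
    and super: "x \<in> subshift T \<Longrightarrow> \<Phi> n x + \<Phi> m ((shift ^^ n) x) \<le> \<Phi> (n + m) x"
    and zero: "\<Phi> 0 x = 0"
begin

definition psi :: "nat \<Rightarrow> nat list \<Rightarrow> real" where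
  "psi n w = (INF x\<in>cylinder T w. \<Phi> n x)"

definition Z :: "nat \<Rightarrow> real" where
  "Z n = (\<Sum>w\<in>admissible_words T n. exp (psi n w))"

lemma bound:
  obtains B where "B \<ge> 0" "\<And>x. x \<in> subshift T \<Longrightarrow> \<bar>\<Phi> n x\<bar> \<le> B"
  using bounded_on_subshift[OF continuous] by metis

lemma bound_upto:
  obtains B where "B \<ge> 0" "\<And>x r. x \<in> subshift T \<Longrightarrow> r \<le> m \<Longrightarrow> \<bar>\<Phi> r x\<bar> \<le> B"
proof -
  have "\<exists>B\<ge>0. \<forall>x r. x \<in> subshift T \<longrightarrow> r \<le> m \<longrightarrow> \<bar>\<Phi> r x\<bar> \<le> B"
  proof (induction m)
    case 0
    then show ?case by (auto simp: zero)
  next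
    case (Suc m)
    then obtain B where "B \<ge> 0" "\<And>x r. x \<in> subshift T \<Longrightarrow> r \<le> m \<Longrightarrow> \<bar>\<Phi> r x\<bar> \<le> B" by blast
    moreover obtain B' where "\<And>x. x \<in> subshift T \<Longrightarrow> \<bar>\<Phi> (Suc m) x\<bar> \<le> B'" using bound by metis
    ultimately show ?case
      by (intro exI[of _ "max B B'"]) (auto simp: le_max_iff_disj le_Suc_eq)
  qed
  then show thesis using that by blast
qed

lemma sum_le_super:
  assumes "x \<in> subshift T"
  shows "(\<Sum>s<t. \<Phi> m ((shift ^^ (s * m)) x)) \<le> \<Phi> (t * m) x"
proof (induction t)
  case (Suc t)
  have "\<Phi> (t * m) x + \<Phi> m ((shift ^^ (t * m)) x) \<le> \<Phi> (t * m + m) x"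
    by (rule super[OF assms])
  then show ?case using Suc by (simp add: algebra_simps)
qed (simp add: zero)

text \<open>For every \<open>y\<close> in the cylinder of \<open>x\<close>, superadditivity bounds
  \<open>\<Phi> n y\<close> below by a sum over blocks of length \<open>m\<close>. A block of
  \<open>y\<close> differs from that of \<open>x\<close> by less than \<open>e\<close>, unless it
  starts within \<open>L\<close> letters of the end; the constant \<open>C\<close> pays for these
  blocks and for the remainder.\<close>

lemma psi_lower_bound:
  assumes m: "m \<ge> 1" and e: "e > 0"
  obtains C where "\<And>n x. x \<in> subshift T \<Longrightarrow>
    (\<Sum>s<n div m. \<Phi> m ((shift ^^ (s * m)) x)) - real n * e - C \<le> psi n (word n x)"
proof -
  obtain L where L: "\<And>x y. x \<in> subshift T \<Longrightarrow> y \<in> subshift T \<Longrightarrow> word L x = word L y \<Longrightarrow> \<bar>\<Phi> m x - \<Phi> m y\<bar> < e"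
    using uniformly_continuous_cylinder[OF continuous e] by metis
  obtain B where B: "B \<ge> 0" "\<And>x r. x \<in> subshift T \<Longrightarrow> r \<le> m \<Longrightarrow> \<bar>\<Phi> r x\<bar> \<le> B"
    using bound_upto by blast
  show thesis
  proof (rule that)
    fix n and x assume x: "x \<in> subshift T"
    let ?t = "n div m"
    have "?t \<le> n" using m by simp
    show "(\<Sum>s<?t. \<Phi> m ((shift ^^ (s * m)) x)) - real n * e - (2 * B * L + B) \<le> psi n (word n x)"
      unfolding psi_def
    proof (rule cINF_greatest)
      show "cylinder T (word n x) \<noteq> {}" using x by (auto simp: in_cylinder_iff)
      fix y assume "y \<in> cylinder T (word n x)"
      then have y: "y \<in> subshift T" "word n y = word n x" by (auto simp: in_cylinder_iff)
      \<comment> \<open>Blocks starting so late that \<open>x\<close> and \<open>y\<close> need not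
        share \<open>L\<close> letters from there on. For such \<open>s\<close>,
        \<open>(?t - s) * m < L\<close>, so with \<open>m \<ge> 1\<close> there are at most
        \<open>L\<close> of them; each costs at most \<open>2 * B\<close>.\<close>
      define W where "W = {s. s < ?t \<and> n < s * m + L}"
      have "W \<subseteq> {?t - L..<?t}"
      proof
        fix s assume s: "s \<in> W"
        then have "?t * m < s * m + L" unfolding W_def
          by (metis (mono_tags, lifting) div_times_less_eq_dividend le_less_trans mem_Collect_eq)
        moreover have "s * m \<le> ?t * m" using s by (intro mult_le_mono1) (simp add: W_def)
        ultimately have "(?t - s) * m < L" by (simp only: diff_mult_distrib)
        moreover have "?t - s \<le> (?t - s) * m" using m by simp
        ultimately have "?t - s < L" by linarith
        then show "s \<in> {?t - L..<?t}" using s by (auto simp: W_def)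
      qed
      then have "card W \<le> card {?t - L..<?t}" by (intro card_mono) auto
      then have W: "card W \<le> L" "finite W" by (auto simp: W_def)
      have step: "\<Phi> m ((shift ^^ (s * m)) x) - e - (if s \<in> W then 2 * B else 0) \<le> \<Phi> m ((shift ^^ (s * m)) y)"
        if s: "s < ?t" for s
      proof (cases "s \<in> W")
        case True
        then show ?thesis
          using B(2)[OF funpow_shift_in_subshift[OF x], of m "s * m"]
            B(2)[OF funpow_shift_in_subshift[OF y(1)], of m "s * m"] e by (auto simp: abs_le_iff)
      next
        case False
        then have "s * m + L \<le> n" using s by (auto simp: W_def)
        then have "word L ((shift ^^ (s * m)) x) = word L ((shift ^^ (s * m)) y)"
          using y(2) by (auto simp: word_eq_iff funpow_shift)
        then show ?thesis
          using L[OF funpow_shift_in_subshift[OF x] funpow_shift_in_subshift[OF y(1)]] False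
          by (force simp: abs_less_iff)
      qed
      have "(\<Sum>s<?t. if s \<in> W then 2 * B else 0) = (\<Sum>s\<in>W. 2 * B)"
        by (intro sum.mono_neutral_cong_right) (auto simp: W_def)
      also have "\<dots> \<le> 2 * B * L" using W B(1) by (simp add: mult.commute mult_left_mono)
      finally have WB: "(\<Sum>s<?t. if s \<in> W then 2 * B else 0) \<le> 2 * B * L" .
      have te: "real ?t * e \<le> real n * e" using \<open>?t \<le> n\<close> e by (intro mult_right_mono) auto
      have "(\<Sum>s<?t. \<Phi> m ((shift ^^ (s * m)) x)) - real ?t * e - (\<Sum>s<?t. if s \<in> W then 2 * B else 0) =
          (\<Sum>s<?t. \<Phi> m ((shift ^^ (s * m)) x) - e - (if s \<in> W then 2 * B else 0))"
        by (simp add: sum_subtractf)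
      also have "\<dots> \<le> (\<Sum>s<?t. \<Phi> m ((shift ^^ (s * m)) y))"
        using step by (intro sum_mono) auto
      also have "\<dots> \<le> \<Phi> (?t * m) y" by (rule sum_le_super[OF y(1)])
      also have "\<dots> \<le> \<Phi> (?t * m + n mod m) y + B"
      proof -
        have "\<bar>\<Phi> (n mod m) ((shift ^^ (?t * m)) y)\<bar> \<le> B"
          using m by (intro B(2) funpow_shift_in_subshift y(1)) simp
        then show ?thesis using super[OF y(1), of "?t * m" "n mod m"] by linarith
      qed
      also have "?t * m + n mod m = n" by simp
      finally show "(\<Sum>s<?t. \<Phi> m ((shift ^^ (s * m)) x)) - real n * e - (2 * B * L + B) \<le> \<Phi> n y"
        using WB te by linarith
    qed
  qed
qed

section \<open>Entropy plus mean of an invariant measure is at most the growth rate of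
  \<open>Z\<close>\<close>

context
  fixes \<mu> assumes \<mu>: "\<mu> \<in> invariant_measures T"
begin

interpretation prob_space \<mu> by (rule invariant_measuresD(1)[OF \<mu>])

lemmas sets_\<mu> = invariant_measuresD(2)[OF \<mu>] and space_\<mu> = invariant_measuresD(3)[OF \<mu>]
  and shift_\<mu> = invariant_measuresD(4)[OF \<mu>] and inv_\<mu> = invariant_measuresD(5)[OF \<mu>]

lemma integrable_potential: "integrable \<mu> (\<lambda>x. \<Phi> m ((shift ^^ n) x))"
  by (rule integrable_distr[OF measurable_funpow[OF shift_\<mu>]])
    (simp add: distr_funpow[OF shift_\<mu> inv_\<mu>] continuous_integrable[OF finite_measure_axioms sets_\<mu> continuous])

lemma integral_potential: "(\<integral>x. \<Phi> m ((shift ^^ n) x) \<partial>\<mu>) = (\<integral>x. \<Phi> m x \<partial>\<mu>)"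
  using integrable_potential[of m 0] by (intro integral_funpow_shift[OF \<mu>]) auto

text \<open>By invariance the integrals are superadditive, so Fekete's lemma applies. The supremum
  form lets a bound for each fixed \<open>m\<close> pass to the asymptotic mean.\<close>

lemma asymptotic_mean_LIMSEQ:
  "(\<lambda>n. ereal ((\<integral>x. \<Phi> n x \<partial>\<mu>) / real n)) \<longlonglongrightarrow> asymptotic_mean \<Phi> \<mu>" (is ?lim)
  "asymptotic_mean \<Phi> \<mu> = (SUP n\<in>{1..}. ereal ((\<integral>x. \<Phi> n x \<partial>\<mu>) / real n))" (is ?sup)
proof -
  have "(\<lambda>n. ereal ((\<integral>x. \<Phi> n x \<partial>\<mu>) / real n)) \<longlonglongrightarrow> (SUP n\<in>{1..}. ereal ((\<integral>x. \<Phi> n x \<partial>\<mu>) / real n))"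
  proof (rule superadditive_LIMSEQ)
    fix n m :: nat
    note int = integrable_potential[of n 0, simplified] integrable_potential[of m n]
    have "(\<integral>x. \<Phi> n x \<partial>\<mu>) + (\<integral>x. \<Phi> m x \<partial>\<mu>) = (\<integral>x. \<Phi> n x + \<Phi> m ((shift ^^ n) x) \<partial>\<mu>)"
      using int by (simp add: integral_potential)
    also have "\<dots> \<le> (\<integral>x. \<Phi> (n + m) x \<partial>\<mu>)"
      using int integrable_potential[of "n + m" 0] super
      by (intro integral_mono) (auto simp: space_\<mu>)
    finally show "(\<integral>x. \<Phi> n x \<partial>\<mu>) + (\<integral>x. \<Phi> m x \<partial>\<mu>) \<le> (\<integral>x. \<Phi> (n + m) x \<partial>\<mu>)" .
  qed
  then show ?lim ?sup unfolding asymptotic_mean_def by (auto simp: limI)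
qed

lemma integrable_psi_word: "integrable \<mu> (\<lambda>x. psi n (word n x))"
  by (rule integrable_simple_compose[OF simple_function_word[OF sets_\<mu>]])

text \<open>By invariance each block contributes the same integral of \<open>\<Phi> m\<close>.
  Passing from \<open>n div m\<close> blocks to \<open>n / m\<close> costs at most one absolute
  value of that integral.\<close>

lemma integral_psi_lower_bound:
  assumes m: "m \<ge> 1" and e: "e > 0"
  obtains C where "\<And>n. real n * ((\<integral>x. \<Phi> m x \<partial>\<mu>) / real m) - real n * e - C \<le> (\<integral>x. psi n (word n x) \<partial>\<mu>)"
proof -
  let ?I = "\<integral>x. \<Phi> m x \<partial>\<mu>"
  obtain C where C: "\<And>n x. x \<in> subshift T \<Longrightarrow>
      (\<Sum>s<n div m. \<Phi> m ((shift ^^ (s * m)) x)) - real n * e - C \<le> psi n (word n x)"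
    using psi_lower_bound[OF m e] by metis
  show thesis
  proof (rule that)
    fix n
    have "real n = real (n div m) * real m + real (n mod m)"
      by (metis div_mult_mod_eq of_nat_add of_nat_mult)
    then have "real n * (?I / real m) = real (n div m) * ?I + real (n mod m) / real m * ?I"
      using m by (simp add: field_simps)
    moreover have "real (n mod m) / real m * ?I \<le> \<bar>?I\<bar>"
    proof -
      have "real (n mod m) / real m * ?I \<le> real (n mod m) / real m * \<bar>?I\<bar>"
        by (intro mult_left_mono) auto
      also have "\<dots> \<le> 1 * \<bar>?I\<bar>" using m by (intro mult_right_mono) (auto simp: less_imp_le)
      finally show ?thesis by simp
    qed
    moreover have "real (n div m) * ?I - real n * e - C =
        (\<integral>x. (\<Sum>s<n div m. \<Phi> m ((shift ^^ (s * m)) x)) - real n * e - C \<partial>\<mu>)"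
      by (simp add: integrable_potential integral_potential Bochner_Integration.integral_sum
          Bochner_Integration.integrable_sum prob_space)
    moreover have "\<dots> \<le> (\<integral>x. psi n (word n x) \<partial>\<mu>)"
      by (rule integral_mono) (auto intro!: Bochner_Integration.integrable_diff
            Bochner_Integration.integrable_sum integrable_psi_word integrable_potential C simp: space_\<mu>)
    ultimately show "real n * (?I / real m) - real n * e - (C + \<bar>?I\<bar>) \<le> (\<integral>x. psi n (word n x) \<partial>\<mu>)"
      by linarith
  qed
qed

lemma nonempty_subshift: "subshift T \<noteq> {}"
  using not_empty space_\<mu> by simp

lemma Z_pos: "Z n > 0"
proof -
  obtain x where "x \<in> subshift T" using nonempty_subshift by blast
  then have "admissible_words T n \<noteq> {}" using word_admissible by blast
  then show ?thesis unfolding Z_def by (intro sum_pos finite_admissible_words) auto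
qed

text \<open>Gibbs' inequality for the pair (itinerary, word). The weight of a pair penalises by \<open>\<delta>\<close> each
  time at which the itinerary differs from the partition element guessed from the next \<open>k\<close> letters,
  which is rare; summing the weights over itineraries thus costs almost nothing.\<close>

lemma entropy_le_partition_function:
  assumes P: "finite_measurable_partition \<mu> P" and e: "e > 0"
  obtains C where "\<And>n. rv_entropy \<mu> (itinerary shift P n) + (\<integral>x. psi n (word n x) \<partial>\<mu>) \<le> ln (Z n) + real n * e + C"
proof -
  have P': "finite P" "partition_on (space \<mu>) P"
    using P by (auto simp: finite_measurable_partition_def)
  have "P \<noteq> {}" using part_of_in(1)[OF P'(2)] nonempty_subshift space_\<mu> by blast
  define p where "p = real (card P)"
  have p: "p \<ge> 1" using \<open>P \<noteq> {}\<close> P'(1) by (simp add: p_def Suc_le_eq card_gt_0_iff)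
  \<comment> \<open>Each time step costs at most \<open>\<delta>\<close> on average for wrong
    guesses and \<open>p * \<delta>\<close> for summing the weights, whence \<open>p + 1\<close>.
    The bound \<open>1 / 2\<close> keeps \<open>ln \<delta>\<close> negative.\<close>
  define \<delta> where "\<delta> = min (1 / 2) (e / (p + 1))"
  have "\<delta> \<le> e / (p + 1)" by (simp add: \<delta>_def)
  then have "\<delta> * (p + 1) \<le> e" using p by (simp add: pos_le_divide_eq)
  moreover have "\<delta> > 0" "\<delta> < 1" using e p by (auto simp: \<delta>_def)
  ultimately have \<delta>: "\<delta> > 0" "\<delta> < 1" "\<delta> * (p + 1) \<le> e" by blast+
  then have ln\<delta>: "ln \<delta> < 0" by simp
  \<comment> \<open>Chosen so that the expected penalty \<open>- ln \<delta> * prob Bad\<close>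
    stays below \<open>\<delta>\<close>.\<close>
  obtain k g where kg: "measure \<mu> {x \<in> space \<mu>. part_of P x \<noteq> g (word k x)} < \<delta> / (- ln \<delta>)"
    using partition_approx_word[OF prob_space_axioms sets_\<mu> P, of "\<delta> / (- ln \<delta>)"] \<delta>(1) ln\<delta>
    by (metis divide_pos_pos neg_0_less_iff_less)
  define Bad where "Bad = {x \<in> space \<mu>. part_of P x \<noteq> g (word k x)}"
  have sf: "simple_function \<mu> (\<lambda>x. part_of P x = g (word k x))"
    using simple_function_compose2[OF simple_function_part_of[OF P measurable_ident_sets[OF refl], unfolded id_def]
        simple_function_word[OF sets_\<mu>], of "\<lambda>a u. a = g u"] by simp
  have Bad: "Bad \<in> sets \<mu>" unfolding Bad_def using simple_function_sets[OF sf, of False] by simp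
  define r where "r a u = (if a = g u then 1 else \<delta>)" for a u
  \<comment> \<open>Near the end of \<open>w\<close> fewer than \<open>k\<close> letters are left
    and no guess is possible, so every partition element gets weight 1.\<close>
  define \<rho> where "\<rho> n w i a = (if i + k \<le> n then r a (take k (drop i w)) else 1)" for n w i a
  have \<rho>pos: "\<rho> n w i a > 0" for n w i a using \<delta>(1) by (auto simp: \<rho>_def r_def)
  show thesis
  proof (rule that)
    fix n
    define V where "V = (PiE {..<n} (\<lambda>_. P)) \<times> admissible_words T n"
    define q where "q = (\<lambda>(c, w). exp (psi n w) * (\<Prod>i<n. \<rho> n w i (c i)))"
    note X1 = simple_function_itinerary[OF P shift_\<mu>, of n]
    note X2 = simple_function_word[OF sets_\<mu>, of n]
    note X = simple_function_pair[OF X1 X2]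
    have V: "finite V" "(\<lambda>x. (itinerary shift P n x, word n x)) ` space \<mu> \<subseteq> V"
      using itinerary_in[OF P shift_\<mu>] word_admissible P'(1) finite_admissible_words
      by (auto simp: V_def space_\<mu> intro!: finite_PiE)
    have qpos: "q v > 0" for v
      unfolding q_def by (cases v) (auto intro!: mult_pos_pos prod_pos \<rho>pos)
    have "(\<integral>x. ln (q (itinerary shift P n x, word n x)) \<partial>\<mu>) +
        rv_entropy \<mu> (\<lambda>x. (itinerary shift P n x, word n x)) \<le> ln (\<Sum>v\<in>V. q v)"
      by (rule gibbs[OF X V]) (use qpos in \<open>auto simp: less_imp_le\<close>)
    moreover have "rv_entropy \<mu> (itinerary shift P n) \<le> rv_entropy \<mu> (\<lambda>x. (itinerary shift P n x, word n x))"
      by (rule rv_entropy_mono[OF X1 X]) auto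
    moreover have "(\<integral>x. psi n (word n x) \<partial>\<mu>) - real n * \<delta> \<le> (\<integral>x. ln (q (itinerary shift P n x, word n x)) \<partial>\<mu>)"
    proof -
      have ind: "integrable \<mu> (\<lambda>x. ln \<delta> * indicator Bad ((shift ^^ i) x))" for i
        using Bad by (intro integrable_mult_right integrable_distr[OF measurable_funpow[OF shift_\<mu>]])
          (simp add: distr_funpow[OF shift_\<mu> inv_\<mu>] less_top[symmetric])
      have "(\<integral>x. indicator Bad ((shift ^^ i) x) \<partial>\<mu>) = prob Bad" for i
        using Bad integral_funpow_shift[OF \<mu>, of "indicator Bad" i] by simp
      then have "(\<integral>x. ln \<delta> * indicator Bad ((shift ^^ i) x) \<partial>\<mu>) = ln \<delta> * prob Bad" for i
        by (simp only: integral_mult_right_zero)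
      then have "(\<integral>x. psi n (word n x) \<partial>\<mu>) + real n * (ln \<delta> * prob Bad) =
          (\<integral>x. psi n (word n x) \<partial>\<mu>) + (\<Sum>i<n. \<integral>x. ln \<delta> * indicator Bad ((shift ^^ i) x) \<partial>\<mu>)"
        by (simp only: sum_constant card_lessThan)
      also have "\<dots> = (\<integral>x. psi n (word n x) + (\<Sum>i<n. ln \<delta> * indicator Bad ((shift ^^ i) x)) \<partial>\<mu>)"
        by (simp only: Bochner_Integration.integral_sum[OF ind]
            Bochner_Integration.integral_add[OF integrable_psi_word Bochner_Integration.integrable_sum[OF ind]])
      also have "\<dots> \<le> (\<integral>x. ln (q (itinerary shift P n x, word n x)) \<partial>\<mu>)"
      proof (rule integral_mono)
        show "integrable \<mu> (\<lambda>x. psi n (word n x) + (\<Sum>i<n. ln \<delta> * indicator Bad ((shift ^^ i) x)))"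
          using ind integrable_psi_word by (intro Bochner_Integration.integrable_add Bochner_Integration.integrable_sum)
        show "integrable \<mu> (\<lambda>x. ln (q (itinerary shift P n x, word n x)))"
          by (rule integrable_simple_compose[OF X])
        fix x assume x: "x \<in> space \<mu>"
        have "ln (q (itinerary shift P n x, word n x)) =
            psi n (word n x) + (\<Sum>i<n. ln (\<rho> n (word n x) i (part_of P ((shift ^^ i) x))))"
        proof -
          have "ln (\<Prod>i<n. \<rho> n (word n x) i (part_of P ((shift ^^ i) x))) =
              (\<Sum>i<n. ln (\<rho> n (word n x) i (part_of P ((shift ^^ i) x))))"
            by (intro ln_prod) (simp_all add: \<rho>pos[THEN less_imp_neq, THEN not_sym])
          moreover have "(\<Prod>i<n. \<rho> n (word n x) i (part_of P ((shift ^^ i) x))) > 0"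
            using \<rho>pos by (intro prod_pos) auto
          ultimately show ?thesis
            unfolding q_def by (simp add: ln_mult itinerary_def less_imp_neq[THEN not_sym])
        qed
        moreover have "ln \<delta> * indicator Bad ((shift ^^ i) x) \<le> ln (\<rho> n (word n x) i (part_of P ((shift ^^ i) x)))"
          if "i < n" for i
        proof -
          have "take k (drop i (word n x)) = word k ((shift ^^ i) x)" if "i + k \<le> n"
            using that by (auto simp: list_eq_iff_nth_eq funpow_shift add.commute)
          then show ?thesis
            using ln\<delta> funpow_in_space[OF shift_\<mu> x, of i]
            by (auto simp: \<rho>_def r_def Bad_def indicator_def)
        qed
        ultimately show "psi n (word n x) + (\<Sum>i<n. ln \<delta> * indicator Bad ((shift ^^ i) x)) \<le>
            ln (q (itinerary shift P n x, word n x))"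
          by (simp only:) (intro add_left_mono sum_mono, simp)
      qed
      finally have "(\<integral>x. psi n (word n x) \<partial>\<mu>) + real n * (ln \<delta> * prob Bad) \<le>
          (\<integral>x. ln (q (itinerary shift P n x, word n x)) \<partial>\<mu>)" .
      moreover have "- \<delta> \<le> ln \<delta> * prob Bad"
        using kg ln\<delta> unfolding Bad_def[symmetric] by (simp add: field_simps)
      then have "real n * (- \<delta>) \<le> real n * (ln \<delta> * prob Bad)" by (rule mult_left_mono) simp
      ultimately show ?thesis by simp
    qed
    moreover have "ln (\<Sum>v\<in>V. q v) \<le> ln (Z n) + real n * (p * \<delta>) + real k * ln p"
    proof -
      \<comment> \<open>Summing over itineraries factorises over times: a time with a guess
        contributes at most \<open>1 + p * \<delta>\<close>, and each of the at most
        \<open>k\<close> times without one contributes \<open>p\<close>. The latter give the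
        constant \<open>k * ln p\<close>.\<close>
      have prod_le: "(\<Prod>i<n. \<Sum>a\<in>P. \<rho> n w i a) \<le> (1 + p * \<delta>) ^ n * p ^ k" for w
      proof -
        have "(\<Prod>i<n. \<Sum>a\<in>P. \<rho> n w i a) \<le> (\<Prod>i<n. (1 + p * \<delta>) * (if i + k \<le> n then 1 else p))"
        proof (rule prod_mono, intro conjI)
          fix i
          show "0 \<le> (\<Sum>a\<in>P. \<rho> n w i a)" using \<rho>pos by (intro sum_nonneg less_imp_le)
          show "(\<Sum>a\<in>P. \<rho> n w i a) \<le> (1 + p * \<delta>) * (if i + k \<le> n then 1 else p)"
          proof (cases "i + k \<le> n")
            case True
            have "(\<Sum>a\<in>P. \<rho> n w i a) \<le> (\<Sum>a\<in>P. (if a = g (take k (drop i w)) then 1 else 0) + \<delta>)"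
              using True \<delta>(1) by (intro sum_mono) (auto simp: \<rho>_def r_def)
            also have "\<dots> \<le> 1 + p * \<delta>" using P'(1) by (simp add: sum.distrib p_def)
            finally show ?thesis using True by simp
          next
            case False
            then show ?thesis using \<delta>(1) p by (simp add: \<rho>_def p_def[symmetric] algebra_simps)
          qed
        qed
        also have "\<dots> = (1 + p * \<delta>) ^ n * p ^ card ({..<n} \<inter> - {i. i + k \<le> n})"
          by (simp add: prod.distrib prod.If_cases)
        also have "\<dots> \<le> (1 + p * \<delta>) ^ n * p ^ k"
        proof -
          have "card ({..<n} \<inter> - {i. i + k \<le> n}) \<le> card {n - k..<n}"
            by (intro card_mono) auto
          then show ?thesis using p \<delta>(1) by (intro mult_left_mono power_increasing) auto
        qed
        finally show ?thesis .
      qed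
      have "(\<Sum>v\<in>V. q v) = (\<Sum>w\<in>admissible_words T n. \<Sum>c\<in>PiE {..<n} (\<lambda>_. P). q (c, w))"
        unfolding V_def by (subst sum.swap) (simp add: sum.cartesian_product)
      also have "\<dots> = (\<Sum>w\<in>admissible_words T n. exp (psi n w) * (\<Prod>i<n. \<Sum>a\<in>P. \<rho> n w i a))"
        using P'(1) by (subst prod_sum_PiE) (auto simp: q_def sum_distrib_left)
      also have "\<dots> \<le> (\<Sum>w\<in>admissible_words T n. exp (psi n w) * ((1 + p * \<delta>) ^ n * p ^ k))"
        using prod_le by (intro sum_mono mult_left_mono) auto
      also have "\<dots> = Z n * ((1 + p * \<delta>) ^ n * p ^ k)"
        by (simp add: Z_def sum_distrib_right)
      finally have "ln (\<Sum>v\<in>V. q v) \<le> ln (Z n * ((1 + p * \<delta>) ^ n * p ^ k))"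
        using qpos V Z_pos[of n] p \<delta>(1) not_empty
        by (subst ln_le_cancel_iff) (auto intro!: sum_pos mult_pos_pos zero_less_power add_pos_nonneg)
      also have "\<dots> = ln (Z n) + real n * ln (1 + p * \<delta>) + real k * ln p"
      proof -
        have "1 + p * \<delta> \<noteq> 0" using mult_pos_pos[of p \<delta>] p \<delta>(1) by linarith
        then show ?thesis using Z_pos[of n] p by (simp add: ln_mult ln_realpow)
      qed
      also have "real n * ln (1 + p * \<delta>) \<le> real n * (p * \<delta>)"
        using p \<delta>(1) by (intro mult_left_mono ln_add_one_self_le_self) auto
      finally show ?thesis by simp
    qed
    moreover have "real n * \<delta> + real n * (p * \<delta>) \<le> real n * e"
      using mult_left_mono[OF \<delta>(3), of "real n"] by (simp add: algebra_simps)
    ultimately show "rv_entropy \<mu> (itinerary shift P n) + (\<integral>x. psi n (word n x) \<partial>\<mu>) \<le>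
        ln (Z n) + real n * e + real k * ln p"
      by linarith
  qed
qed

text \<open>In the sum of the two preceding bounds the integral of \<open>psi n (word n x)\<close>
  cancels. After division by \<open>n\<close> the constants vanish, and \<open>e\<close> is
  arbitrary.\<close>

lemma entropy_partition_le_liminf:
  assumes P: "finite_measurable_partition \<mu> P" and m: "m \<ge> 1"
  shows "entropy_wrt_partition \<mu> shift P + ereal ((\<integral>x. \<Phi> m x \<partial>\<mu>) / real m) \<le>
    liminf (\<lambda>n. ereal (ln (Z n) / real n))"
proof (rule ereal_le_epsilon2)
  fix e :: real assume e: "0 < e"
  let ?h = "entropy_wrt_partition \<mu> shift P" and ?F = "(\<integral>x. \<Phi> m x \<partial>\<mu>) / real m"
  obtain C1 where C1: "\<And>n. real n * ?F - real n * (e / 2) - C1 \<le> (\<integral>x. psi n (word n x) \<partial>\<mu>)"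
    using integral_psi_lower_bound[OF m, of "e / 2"] e by (metis half_gt_zero)
  obtain C2 where C2: "\<And>n. rv_entropy \<mu> (itinerary shift P n) + (\<integral>x. psi n (word n x) \<partial>\<mu>) \<le>
      ln (Z n) + real n * (e / 2) + C2"
    using entropy_le_partition_function[OF P, of "e / 2"] e by (metis half_gt_zero)
  let ?f = "\<lambda>n. ereal (rv_entropy \<mu> (itinerary shift P n) / real n) + ereal (?F - e - (C1 + C2) / real n)"
  have "(\<lambda>n. ?F - e - (C1 + C2) / real n) \<longlonglongrightarrow> ?F - e - 0"
    by (intro tendsto_intros lim_const_over_n)
  then have "(\<lambda>n. ereal (?F - e - (C1 + C2) / real n)) \<longlonglongrightarrow> ereal (?F - e)" by simp
  then have "?f \<longlonglongrightarrow> ?h + ereal (?F - e)"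
    by (intro tendsto_add_ereal_general entropy_wrt_partition_LIMSEQ[OF prob_space_axioms P shift_\<mu> inv_\<mu>]) auto
  then have "?h + ereal (?F - e) = liminf ?f"
    by (intro lim_imp_Liminf[symmetric]) auto
  also have "\<dots> \<le> liminf (\<lambda>n. ereal (ln (Z n) / real n))"
  proof (rule Liminf_mono, rule eventually_sequentiallyI[of 1])
    fix n :: nat assume n: "1 \<le> n"
    have "rv_entropy \<mu> (itinerary shift P n) + real n * (?F - e) - (C1 + C2) \<le> ln (Z n)"
      using C1[of n] C2[of n] by (simp add: algebra_simps)
    then have "(rv_entropy \<mu> (itinerary shift P n) + real n * (?F - e) - (C1 + C2)) / real n \<le> ln (Z n) / real n"
      by (rule divide_right_mono) simp
    then show "?f n \<le> ereal (ln (Z n) / real n)" using n by (simp add: add_divide_distrib diff_divide_distrib)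
  qed
  finally have "?h + ereal (?F - e) + ereal e \<le> liminf (\<lambda>n. ereal (ln (Z n) / real n)) + ereal e"
    by (rule add_right_mono)
  then show "?h + ereal ?F \<le> liminf (\<lambda>n. ereal (ln (Z n) / real n)) + ereal e"
    by (simp add: add.assoc)
qed

text \<open>The bound for one partition and one \<open>m\<close> passes to two suprema: over
  partitions with \<open>m\<close> fixed, then over \<open>m\<close>.\<close>

lemma entropy_plus_mean_le_liminf:
  "KS_entropy \<mu> shift + asymptotic_mean \<Phi> \<mu> \<le> liminf (\<lambda>n. ereal (ln (Z n) / real n))"
proof -
  let ?l = "liminf (\<lambda>n. ereal (ln (Z n) / real n))"
  let ?F = "\<lambda>m. ereal ((\<integral>x. \<Phi> m x \<partial>\<mu>) / real m)"
  have trivial: "finite_measurable_partition \<mu> {space \<mu>}"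
    using not_empty by (auto simp: finite_measurable_partition_def partition_on_def)
  \<comment> \<open>An entropy of \<open>- \<infinity>\<close> would prevent exchanging the sum with
    the supremum over \<open>m\<close>, which may be infinite.\<close>
  have h0: "KS_entropy \<mu> shift \<noteq> - \<infinity>"
  proof -
    have "0 \<le> entropy_wrt_partition \<mu> shift {space \<mu>}"
      by (rule entropy_wrt_partition_nonneg[OF prob_space_axioms trivial shift_\<mu> inv_\<mu>])
    also have "\<dots> \<le> KS_entropy \<mu> shift"
      unfolding KS_entropy_def using trivial by (intro SUP_upper) auto
    finally show ?thesis by auto
  qed
  have *: "KS_entropy \<mu> shift + ?F m \<le> ?l" if "m \<ge> 1" for m
  proof -
    have "KS_entropy \<mu> shift + ?F m = (SUP P \<in> {P. finite_measurable_partition \<mu> P}. entropy_wrt_partition \<mu> shift P + ?F m)"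
      unfolding KS_entropy_def using trivial by (intro SUP_ereal_add_left[symmetric]) auto
    also have "\<dots> \<le> ?l" using entropy_partition_le_liminf[OF _ that] by (intro SUP_least) auto
    finally show ?thesis .
  qed
  have "KS_entropy \<mu> shift + asymptotic_mean \<Phi> \<mu> = (SUP m\<in>{1..}. ?F m + KS_entropy \<mu> shift)"
    unfolding asymptotic_mean_LIMSEQ(2) using h0
    by (subst add.commute, intro SUP_ereal_add_left[symmetric]) auto
  also have "\<dots> \<le> ?l" using * by (intro SUP_least) (auto simp: add.commute)
  finally show ?thesis .
qed

end

end

section \<open>Measures coded by independent words\<close>

text \<open>\<open>K\<close> is an exponent for which the power of \<open>T\<close> is positive. One
  path length for all pairs of letters gives all blocks the same length.\<close>

locale block_coding = superadditive_potential +
  fixes K m :: nat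
  assumes dim_pos: "dim_row T \<ge> 1" and K: "K \<ge> 1" and m: "m \<ge> 1"
    and connect: "a < dim_row T \<Longrightarrow> b < dim_row T \<Longrightarrow>
      \<exists>s. s 0 = a \<and> s K = b \<and> (\<forall>i\<le>K. s i < dim_row T) \<and> (\<forall>i<K. T $$ (s i, s (Suc i)) = 1)"
begin

definition conn :: "nat \<Rightarrow> nat \<Rightarrow> nat \<Rightarrow> nat" where
  "conn a b = (SOME s. s 0 = a \<and> s K = b \<and> (\<forall>i\<le>K. s i < dim_row T) \<and> (\<forall>i<K. T $$ (s i, s (Suc i)) = 1))"

lemma conn:
  assumes "a < dim_row T" "b < dim_row T"
  shows "conn a b 0 = a" "conn a b K = b" "i \<le> K \<Longrightarrow> conn a b i < dim_row T"
    "i < K \<Longrightarrow> T $$ (conn a b i, conn a b (Suc i)) = 1"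
  using someI_ex[OF connect[OF assms]] unfolding conn_def[symmetric] by blast+

text \<open>The end points of a connecting path are the last letter of one word and the first letter
  of the next, so the path adds only \<open>K - 1\<close> letters.\<close>

definition L :: nat where "L = m + K - 1"

lemma L: "m \<le> L" "0 < L" "L - (m - 1) = K" "L = m + (K - 1)"
  using K m by (auto simp: L_def)

definition W :: "nat list set" where "W = admissible_words T m"

lemma W_nth: "w \<in> W \<Longrightarrow> i < m \<Longrightarrow> w ! i < dim_row T"
proof -
  assume "w \<in> W" "i < m"
  then have "set w \<subseteq> {..<dim_row T}" "w ! i \<in> set w" by (auto simp: W_def admissible_words_def)
  then show ?thesis by blast
qed

lemma W_adj: "w \<in> W \<Longrightarrow> Suc i < m \<Longrightarrow> T $$ (w ! i, w ! Suc i) = 1"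
  by (simp add: W_def admissible_words_def)

lemma W_length: "w \<in> W \<Longrightarrow> length w = m"
  by (simp add: W_def admissible_words_def)

lemma finite_W: "finite W"
  unfolding W_def by (rule finite_admissible_words)

text \<open>A sequence of words of length \<open>m\<close> is coded by the point that joins consecutive words with connecting
  paths of \<open>K\<close> steps; a word and the path after it occupy \<open>L = m + K - 1\<close> letters.\<close>

definition blk :: "(nat \<Rightarrow> nat list) \<Rightarrow> nat \<Rightarrow> nat \<Rightarrow> nat" where
  "blk \<omega> b r = (if r < m then \<omega> b ! r else conn (\<omega> b ! (m - 1)) (\<omega> (Suc b) ! 0) (r - (m - 1)))"

definition concat_words :: "(nat \<Rightarrow> nat list) \<Rightarrow> nat \<Rightarrow> nat" where
  "concat_words \<omega> i = blk \<omega> (i div L) (i mod L)"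

text \<open>\<open>Suc r\<close> may equal \<open>L\<close>: there \<open>blk\<close> returns the
  end point of the path, which \<open>blk_end\<close> identifies with the first letter of the next
  block. Transitions between blocks are thereby included.\<close>

lemma blk_adj:
  assumes \<omega>: "\<And>i. \<omega> i \<in> W" and r: "r < L"
  shows "blk \<omega> b r < dim_row T" "T $$ (blk \<omega> b r, blk \<omega> b (Suc r)) = 1"
proof -
  let ?a = "\<omega> b ! (m - 1)" and ?c = "\<omega> (Suc b) ! 0"
  have ac: "?a < dim_row T" "?c < dim_row T" using W_nth[OF \<omega>] m by auto
  have conn_r: "r - (m - 1) < K" using r L by linarith
  show "blk \<omega> b r < dim_row T"
    using W_nth[OF \<omega>] conn(3)[OF ac] conn_r by (auto simp: blk_def)
  consider "Suc r < m" | "r = m - 1" | "r \<ge> m" using m by linarith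
  then show "T $$ (blk \<omega> b r, blk \<omega> b (Suc r)) = 1"
  proof cases
    case 1
    then show ?thesis using W_adj[OF \<omega>] by (simp add: blk_def)
  \<comment> \<open>The last letter of the word is also time 0 of the connecting path, so this
    transition is the first step of the path.\<close>
  next
    case 2
    then show ?thesis using conn(1)[OF ac] conn(4)[OF ac, of 0] K m by (simp add: blk_def)
  next
    case 3
    then have "Suc r - (m - 1) = Suc (r - (m - 1))" using m by linarith
    then show ?thesis using conn(4)[OF ac conn_r] 3 by (simp add: blk_def)
  qed
qed

lemma blk_end:
  assumes \<omega>: "\<And>i. \<omega> i \<in> W"
  shows "blk \<omega> b L = blk \<omega> (Suc b) 0"
  using conn(2)[of "\<omega> b ! (m - 1)" "\<omega> (Suc b) ! 0"] W_nth[OF \<omega>] L m by (simp add: blk_def)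

lemma concat_words_in_subshift:
  assumes \<omega>: "\<And>i. \<omega> i \<in> W"
  shows "concat_words \<omega> \<in> subshift T"
  unfolding subshift_def
proof (intro CollectI allI conjI)
  fix i
  have r: "i mod L < L" using L by simp
  show "concat_words \<omega> i < dim_row T" unfolding concat_words_def by (rule blk_adj(1)[OF \<omega> r])
  have "concat_words \<omega> (Suc i) = blk \<omega> (i div L) (Suc (i mod L))"
    using blk_end[where \<omega> = \<omega> and b = "i div L", OF \<omega>] by (auto simp: concat_words_def div_Suc mod_Suc)
  then show "T $$ (concat_words \<omega> i, concat_words \<omega> (Suc i)) = 1"
    using blk_adj(2)[OF \<omega> r] by (simp add: concat_words_def)
qed

lemma concat_words_block:
  assumes "r < m"
  shows "concat_words \<omega> (b * L + r) = \<omega> b ! r"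
proof -
  have "r < L" using assms L by linarith
  then show ?thesis using assms by (simp add: concat_words_def blk_def)
qed

lemma word_concat_words:
  assumes "\<omega> b \<in> W"
  shows "word m ((shift ^^ (b * L)) (concat_words \<omega>)) = \<omega> b"
  using concat_words_block W_length[OF assms]
  by (auto simp: list_eq_iff_nth_eq funpow_shift add.commute)

lemma shift_concat_words: "(shift ^^ L) (concat_words \<omega>) = concat_words (shift \<omega>)"
  using L(2) by (auto simp: funpow_shift concat_words_def shift_def blk_def fun_eq_iff)

text \<open>Since \<open>K \<ge> 1\<close>, the path from a letter to itself starts with an
  admissible transition; iterating a choice of successors gives a point.\<close>

lemma exists_point: "subshift T \<noteq> {}"
proof -
  have "\<exists>b. b < dim_row T \<and> T $$ (a, b) = 1" if "a < dim_row T" for a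
    using conn[OF that that] K by (intro exI[of _ "conn a a 1"]) (metis One_nat_def less_eq_Suc_le)
  then obtain succ where succ: "\<And>a. a < dim_row T \<Longrightarrow> succ a < dim_row T \<and> T $$ (a, succ a) = 1" by metis
  define x where "x i = (succ ^^ i) 0" for i
  have "x i < dim_row T" for i by (induction i) (use succ dim_pos in \<open>auto simp: x_def\<close>)
  then have "x \<in> subshift T" using succ by (auto simp: subshift_def x_def)
  then show ?thesis by blast
qed

lemma W_nonempty: "W \<noteq> {}"
  using exists_point word_admissible unfolding W_def by blast

lemma psi_le:
  assumes "x \<in> subshift T"
  shows "psi m (word m x) \<le> \<Phi> m x"
  unfolding psi_def
  by (rule cINF_lower[OF bdd_below_cylinder[OF continuous]]) (use assms in \<open>auto simp: in_cylinder_iff\<close>)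

lemma Z_pos': "Z m > 0"
  unfolding Z_def using W_nonempty finite_W unfolding W_def by (intro sum_pos) auto

section \<open>The random sequence of words and the invariant measure it induces\<close>

definition pr :: "nat list \<Rightarrow> real" where "pr w = exp (psi m w) / Z m"

lemma pr_pos: "pr w > 0" using Z_pos' by (simp add: pr_def)

text \<open>The alphabet of the Bernoulli process: one of its letters is a whole word of length
  \<open>m\<close>.\<close>

definition letter :: "nat list measure" where "letter = point_measure W (\<lambda>w. ennreal (pr w))"

definition words :: "(nat \<Rightarrow> nat list) measure" where "words = PiM UNIV (\<lambda>_. letter)"

definition offset :: "nat measure" where "offset = uniform_count_measure {..<L}"

text \<open>The suspension of constant height \<open>L\<close> over the Bernoulli shift. The uniform
  offset upgrades invariance under \<open>shift ^^ L\<close> to invariance under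
  \<open>shift\<close>.\<close>

definition tower :: "((nat \<Rightarrow> nat list) \<times> nat) measure" where "tower = words \<Otimes>\<^sub>M offset"

lemma prob_space_letter: "prob_space letter"
  unfolding letter_def
proof (rule prob_space_point_measure)
  show "(\<Sum>w\<in>W. ennreal (pr w)) = 1"
    using pr_pos Z_pos' by (simp add: sum_ennreal less_imp_le pr_def sum_divide_distrib[symmetric] Z_def W_def)
qed (auto simp: finite_W)

lemma prob_space_words: "prob_space words"
  unfolding words_def by (intro prob_space_PiM prob_space_letter)

lemma prob_space_offset: "prob_space offset"
  unfolding offset_def using L(2) by (intro prob_space_uniform_count_measure) (auto simp: lessThan_empty_iff)

lemma prob_space_tower: "prob_space tower"
  unfolding tower_def by (intro prob_space_pair prob_space_words prob_space_offset)

lemma space_words: "\<omega> \<in> space words \<longleftrightarrow> (\<forall>i. \<omega> i \<in> W)"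
  by (auto simp: words_def space_PiM letter_def space_point_measure PiE_def)

lemma space_offset: "space offset = {..<L}"
  by (simp add: offset_def space_uniform_count_measure)

lemma space_tower: "(\<omega>, j) \<in> space tower \<longleftrightarrow> (\<forall>i. \<omega> i \<in> W) \<and> j < L"
  using space_words by (auto simp: tower_def space_pair_measure space_offset)

lemma measurable_coord_words: "(\<lambda>\<omega>. \<omega> i) \<in> measurable words letter"
  unfolding words_def by (rule measurable_component_singleton) simp

lemma simple_function_letter: "simple_function letter f"
  unfolding simple_function_def letter_def
  using finite_W by (auto simp: space_point_measure sets_point_measure)

lemma simple_function_coord: "simple_function words (\<lambda>\<omega>. f (\<omega> i))"
  by (rule simple_function_measurable_comp[OF measurable_coord_words simple_function_letter])

text \<open>Each coordinate of the coded point is a function of only two consecutive words, hence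
  simple.\<close>

lemma measurable_concat_words: "concat_words \<in> measurable words (borel_subshift T)"
proof (rule measurable_restrict_space2)
  show "concat_words \<in> space words \<rightarrow> subshift T"
    using concat_words_in_subshift by (auto simp: space_words)
  show "concat_words \<in> borel_measurable words"
  proof (rule measurable_coordinatewise_then_product)
    fix i
    have "simple_function words (\<lambda>\<omega>. blk \<omega> (i div L) (i mod L))"
      using simple_function_compose2[OF simple_function_coord[of "\<lambda>w. w" "i div L"] simple_function_coord[of "\<lambda>w. w" "Suc (i div L)"],
          of "\<lambda>u v. if i mod L < m then u ! (i mod L) else conn (u ! (m - 1)) (v ! 0) (i mod L - (m - 1))"]
      by (simp add: blk_def)
    then show "(\<lambda>\<omega>. concat_words \<omega> i) \<in> borel_measurable words"
      unfolding concat_words_def by (rule borel_measurable_simple_function)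
  qed
qed

definition coding :: "(nat \<Rightarrow> nat list) \<times> nat \<Rightarrow> nat \<Rightarrow> nat" where
  "coding = (\<lambda>(\<omega>, j). (shift ^^ j) (concat_words \<omega>))"

lemma measurable_coding: "coding \<in> measurable tower (borel_subshift T)"
proof -
  have "(\<lambda>\<omega>. coding (\<omega>, j)) \<in> measurable words (borel_subshift T)" for j
    using measurable_comp[OF measurable_concat_words measurable_funpow[OF measurable_shift, of j]]
    by (simp add: coding_def comp_def)
  \<comment> \<open>The offset takes countably many values, so measurability may be checked for each
    fixed \<open>j\<close>.\<close>
  then have "(\<lambda>(j, \<omega>). coding (\<omega>, j)) \<in> measurable (count_space {..<L} \<Otimes>\<^sub>M words) (borel_subshift T)"
    by (intro measurable_pair_measure_countable1) auto
  from measurable_pair_swap[OF this]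
  have "coding \<in> measurable (words \<Otimes>\<^sub>M count_space {..<L}) (borel_subshift T)" by simp
  moreover have sets: "sets tower = sets (words \<Otimes>\<^sub>M count_space {..<L})"
    unfolding tower_def offset_def
    by (intro sets_pair_measure_cong refl sets_uniform_count_measure_count_space)
  ultimately show ?thesis by (simp add: measurable_cong_sets[OF sets refl])
qed

definition \<mu> :: "(nat \<Rightarrow> nat) measure" where "\<mu> = distr tower (borel_subshift T) coding"

lemma emeasure_\<mu>:
  assumes A: "A \<in> sets (borel_subshift T)"
  shows "emeasure \<mu> A = (\<Sum>j<L. ennreal (1 / L) * emeasure words {\<omega>\<in>space words. (shift ^^ j) (concat_words \<omega>) \<in> A})"
proof -
  interpret words: prob_space words by (rule prob_space_words)
  interpret offset: prob_space offset by (rule prob_space_offset)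
  interpret pair_sigma_finite words offset ..
  have "emeasure \<mu> A = emeasure (words \<Otimes>\<^sub>M offset) (coding -` A \<inter> space tower)"
    unfolding \<mu>_def using emeasure_distr[OF measurable_coding A] by (simp add: tower_def)
  also have "\<dots> = (\<integral>\<^sup>+j. emeasure words ((\<lambda>\<omega>. (\<omega>, j)) -` (coding -` A \<inter> space tower)) \<partial>offset)"
    using measurable_sets[OF measurable_coding A] by (intro emeasure_pair_measure_alt2) (simp add: tower_def)
  also have "\<dots> = (\<Sum>j<L. ennreal (1 / L) * emeasure words ((\<lambda>\<omega>. (\<omega>, j)) -` (coding -` A \<inter> space tower)))"
    unfolding offset_def uniform_count_measure_def by (subst nn_integral_point_measure_finite) auto
  also have "\<dots> = (\<Sum>j<L. ennreal (1 / L) * emeasure words {\<omega>\<in>space words. (shift ^^ j) (concat_words \<omega>) \<in> A})"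
    by (intro sum.cong refl arg_cong2[where f = "(*)"] arg_cong2[where f = emeasure])
      (auto simp: space_tower space_words coding_def)
  finally show ?thesis .
qed

lemma distr_words_shift: "shift \<in> measurable words words" "distr words words shift = words"
proof -
  have "distr (PiM UNIV (\<lambda>_. letter)) (PiM UNIV (\<lambda>i::nat. letter)) (\<lambda>\<omega>. \<lambda>n\<in>UNIV. \<omega> (Suc n)) = PiM UNIV (\<lambda>i::nat. letter)"
    by (rule distr_PiM_reindex[where f = Suc and M = "\<lambda>_. letter"]) (auto intro: prob_space_letter)
  then show "distr words words shift = words"
    by (simp add: words_def shift_def[abs_def] restrict_UNIV)
  show "shift \<in> measurable words words"
    unfolding shift_def words_def by (intro measurable_abs_UNIV measurable_component_singleton) simp
qed

text \<open>Applying \<open>shift\<close> replaces the summand of offset \<open>j\<close> by that of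
  \<open>j + 1\<close>. The new last summand equals the lost first one: \<open>shift ^^ L\<close>
  acts on coded points as a shift of the word sequence, which preserves its law.\<close>

lemma \<mu>_invariant: "\<mu> \<in> invariant_measures T"
proof -
  have sets: "sets \<mu> = sets (borel_subshift T)" by (simp add: \<mu>_def)
  have sh: "shift \<in> measurable \<mu> \<mu>"
    using measurable_shift by (simp add: measurable_cong_sets[OF sets sets])
  have "distr \<mu> \<mu> shift = \<mu>"
  proof (rule measure_eqI)
    fix A assume "A \<in> sets (distr \<mu> \<mu> shift)"
    then have A: "A \<in> sets (borel_subshift T)" by (simp add: sets)
    define e where "e j = ennreal (1 / L) * emeasure words {\<omega>\<in>space words. (shift ^^ j) (concat_words \<omega>) \<in> A}" for j
    let ?B = "shift -` A \<inter> space \<mu>"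
    have B: "?B \<in> sets (borel_subshift T)" using measurable_sets[OF sh] A sets by auto
    have spc: "space \<mu> = subshift T" using sets_eq_imp_space_eq[OF sets] by simp
    have "emeasure (distr \<mu> \<mu> shift) A = emeasure \<mu> ?B"
      using emeasure_distr[OF sh] A sets by simp
    also have "\<dots> = (\<Sum>j<L. e (Suc j))"
      unfolding emeasure_\<mu>[OF B] e_def
      by (intro sum.cong refl arg_cong2[where f = "(*)"] arg_cong2[where f = emeasure])
        (auto simp: spc space_words intro!: funpow_shift_in_subshift concat_words_in_subshift)
    also have "\<dots> = (\<Sum>j<L. e j)"
    proof -
      obtain L' where L': "L = Suc L'" using L(2) gr0_implies_Suc by blast
      have "{\<omega>\<in>space words. concat_words \<omega> \<in> A} \<in> sets words"
        using measurable_sets[OF measurable_concat_words A] by (simp add: vimage_def Int_def conj_commute)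
      then have "emeasure (distr words words shift) {\<omega>\<in>space words. concat_words \<omega> \<in> A} =
          emeasure words (shift -` {\<omega>\<in>space words. concat_words \<omega> \<in> A} \<inter> space words)"
        by (rule emeasure_distr[OF distr_words_shift(1)])
      also have "shift -` {\<omega>\<in>space words. concat_words \<omega> \<in> A} \<inter> space words =
          {\<omega>\<in>space words. (shift ^^ L) (concat_words \<omega>) \<in> A}"
        using measurable_space[OF distr_words_shift(1)] by (auto simp: shift_concat_words)
      finally have "e L = e 0" by (simp add: e_def distr_words_shift(2))
      then show ?thesis
        unfolding L' by (subst (2) sum.lessThan_Suc_shift) (simp add: add.commute)
    qed
    also have "\<dots> = emeasure \<mu> A" unfolding emeasure_\<mu>[OF A] e_def ..
    finally show "emeasure (distr \<mu> \<mu> shift) A = emeasure \<mu> A" .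
  qed (simp add: sets)
  moreover have "prob_space \<mu>"
    unfolding \<mu>_def by (intro prob_space.prob_space_distr prob_space_tower measurable_coding)
  ultimately show ?thesis using sets by (simp add: invariant_measures_def)
qed

end

text \<open>The partition whose entropy bounds that of the coded measure from below.
  \<open>partition_on\<close> excludes the empty set, hence its removal.\<close>

definition letter_partition :: "nat mat \<Rightarrow> (nat \<Rightarrow> nat) set set" where
  "letter_partition T = (\<lambda>a. {x \<in> subshift T. x 0 = a}) ` {..<dim_row T} - {{}}"

lemma letter_partition_measurable:
  assumes sets: "sets M = sets (borel_subshift T)"
  shows "finite_measurable_partition M (letter_partition T)"
proof -
  have space: "space M = subshift T" using sets_eq_imp_space_eq[OF sets] by simp
  have "{x \<in> subshift T. x 0 = a} \<in> sets M" for a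
  proof -
    have "{x \<in> space M. word 1 x = [a]} \<in> sets M"
      by (rule simple_function_sets[OF simple_function_word[OF sets]])
    then show ?thesis by (simp add: word_def space)
  qed
  moreover have "partition_on (subshift T) (letter_partition T)"
    unfolding letter_partition_def partition_on_def disjoint_def
    by (auto simp: subshift_def)
  ultimately show ?thesis
    by (auto simp: finite_measurable_partition_def space letter_partition_def)
qed

lemma part_of_letter_partition:
  assumes "x \<in> subshift T"
  shows "part_of (letter_partition T) x = {y \<in> subshift T. y 0 = x 0}"
proof (rule part_of_eq)
  show "partition_on (subshift T) (letter_partition T)"
    using letter_partition_measurable[of "borel_subshift T"]
    by (simp add: finite_measurable_partition_def)
  have "x \<in> {y \<in> subshift T. y 0 = x 0}" "x 0 < dim_row T" using assms by (auto simp: subshift_def)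
  then show "{y \<in> subshift T. y 0 = x 0} \<in> letter_partition T" "x \<in> {y \<in> subshift T. y 0 = x 0}"
    unfolding letter_partition_def by blast+
qed

lemma itinerary_letter_partition_imp_word:
  assumes x: "x \<in> subshift T" and y: "y \<in> subshift T"
    and eq: "itinerary shift (letter_partition T) n x = itinerary shift (letter_partition T) n y"
  shows "word n x = word n y"
  unfolding word_eq_iff
proof (intro allI impI)
  fix i assume "i < n"
  then have "part_of (letter_partition T) ((shift ^^ i) x) = part_of (letter_partition T) ((shift ^^ i) y)"
    using fun_cong[OF eq, of i] by (simp add: itinerary_def)
  moreover have "(shift ^^ i) y \<in> part_of (letter_partition T) ((shift ^^ i) y)"
    by (simp add: part_of_letter_partition funpow_shift_in_subshift y)
  ultimately have "(shift ^^ i) y \<in> {z \<in> subshift T. z 0 = ((shift ^^ i) x) 0}"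
    using part_of_letter_partition[OF funpow_shift_in_subshift[OF x]] by auto
  then show "x i = y i" by (simp add: funpow_shift)
qed

section \<open>Mean and entropy of the coded measure\<close>

context block_coding
begin

text \<open>The quantity that cancels: a word contributes \<open>ln (Z m) - mean\<close> to the
  entropy and at least \<open>mean - B\<close> to the potential.\<close>

definition mean :: real where "mean = (\<integral>w. psi m w \<partial>letter)"

lemma distr_tower_fst: "distr tower words fst = words"
  unfolding tower_def by (rule prob_space.distr_pair_fst[OF prob_space_offset])

lemma measurable_fst_tower: "fst \<in> measurable tower words"
  unfolding tower_def by (rule measurable_fst)

lemma integral_words_psi:
  "integrable words (\<lambda>\<omega>. psi m (\<omega> b))" "(\<integral>\<omega>. psi m (\<omega> b) \<partial>words) = mean"
proof -
  interpret letter: prob_space letter by (rule prob_space_letter)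
  have int: "integrable letter (psi m)" by (rule letter.integrable_simple[OF simple_function_letter])
  have d: "distr words letter (\<lambda>\<omega>. \<omega> b) = letter"
    unfolding words_def by (rule distr_PiM_component[of UNIV "\<lambda>_. letter" b]) (auto intro: prob_space_letter)
  show "integrable words (\<lambda>\<omega>. psi m (\<omega> b))"
    using int by (intro integrable_distr[OF measurable_coord_words]) (simp add: d)
  show "(\<integral>\<omega>. psi m (\<omega> b) \<partial>words) = mean"
    using integral_distr[OF measurable_coord_words, of "psi m" b] int by (simp add: d mean_def)
qed

lemma integral_tower_psi:
  "integrable tower (\<lambda>z. psi m (fst z b))" "(\<integral>z. psi m (fst z b) \<partial>tower) = mean"
proof -
  show "integrable tower (\<lambda>z. psi m (fst z b))"
    using integral_words_psi(1) by (intro integrable_distr[OF measurable_fst_tower]) (simp add: distr_tower_fst)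
  show "(\<integral>z. psi m (fst z b) \<partial>tower) = mean"
    using integral_distr[OF measurable_fst_tower, of "\<lambda>\<omega>. psi m (\<omega> b)"] integral_words_psi[of b]
    by (simp add: distr_tower_fst)
qed

text \<open>Split the block into its word, where \<open>psi m\<close> is a lower bound, and the
  \<open>K - 1\<close> letters of the path. The loss \<open>B\<close> bounds
  \<open>\<Phi> (K - 1)\<close>, so it can be chosen independently of \<open>m\<close>.\<close>

lemma potential_block:
  assumes B: "\<And>x. x \<in> subshift T \<Longrightarrow> \<bar>\<Phi> (K - 1) x\<bar> \<le> B" and \<omega>: "\<And>i. \<omega> i \<in> W"
  shows "psi m (\<omega> b) - B \<le> \<Phi> L ((shift ^^ (b * L)) (concat_words \<omega>))"
proof -
  let ?x = "(shift ^^ (b * L)) (concat_words \<omega>)"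
  have x: "?x \<in> subshift T" by (intro funpow_shift_in_subshift concat_words_in_subshift \<omega>)
  have "psi m (\<omega> b) \<le> \<Phi> m ?x"
    using psi_le[OF x] word_concat_words[of \<omega> b] \<omega> by simp
  moreover have "\<bar>\<Phi> (K - 1) ((shift ^^ m) ?x)\<bar> \<le> B"
    by (rule B[OF funpow_shift_in_subshift[OF x]])
  moreover have "\<Phi> m ?x + \<Phi> (K - 1) ((shift ^^ m) ?x) \<le> \<Phi> L ?x"
    using super[OF x, of m "K - 1"] L(4) by simp
  ultimately show ?thesis by linarith
qed

text \<open>A window of \<open>Suc t * L\<close> letters starting at offset \<open>j\<close>
  consists of the last \<open>L - j\<close> letters of block 0, the full blocks 1 to
  \<open>t\<close>, and \<open>j\<close> letters of the next one. The two partial blocks cost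
  \<open>B2\<close> each; \<open>B2\<close> may depend on \<open>m\<close>, as \<open>t\<close>
  grows with \<open>m\<close> fixed.\<close>

lemma potential_coding:
  assumes B: "\<And>x. x \<in> subshift T \<Longrightarrow> \<bar>\<Phi> (K - 1) x\<bar> \<le> B"
    and B2: "\<And>x r. x \<in> subshift T \<Longrightarrow> r \<le> L \<Longrightarrow> \<bar>\<Phi> r x\<bar> \<le> B2"
    and \<omega>: "\<And>i. \<omega> i \<in> W" and j: "j < L"
  shows "(\<Sum>b<t. psi m (\<omega> (Suc b)) - B) - 2 * B2 \<le> \<Phi> (Suc t * L) (coding (\<omega>, j))"
proof -
  let ?x = "concat_words \<omega>"
  have X: "(shift ^^ i) ?x \<in> subshift T" for i
    by (intro funpow_shift_in_subshift concat_words_in_subshift \<omega>)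
  have sh: "(shift ^^ a) ((shift ^^ b) y) = (shift ^^ (b + a)) y" for a b and y :: "nat \<Rightarrow> nat"
    by (simp add: funpow_shift add.commute add.left_commute)
  have "(\<Sum>b<t. psi m (\<omega> (Suc b)) - B) \<le> (\<Sum>b<t. \<Phi> L ((shift ^^ (b * L)) ((shift ^^ L) ?x)))"
  proof (rule sum_mono)
    fix b
    show "psi m (\<omega> (Suc b)) - B \<le> \<Phi> L ((shift ^^ (b * L)) ((shift ^^ L) ?x))"
      using potential_block[where \<omega> = \<omega> and b = "Suc b", OF B \<omega>] by (simp add: sh)
  qed
  also have "\<dots> \<le> \<Phi> (t * L) ((shift ^^ L) ?x)" by (rule sum_le_super[OF X])
  finally have 1: "(\<Sum>b<t. psi m (\<omega> (Suc b)) - B) \<le> \<Phi> (t * L) ((shift ^^ L) ?x)" .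
  have "\<Phi> (L - j) ((shift ^^ j) ?x) + \<Phi> (t * L) ((shift ^^ (L - j)) ((shift ^^ j) ?x)) \<le>
      \<Phi> (L - j + t * L) ((shift ^^ j) ?x)" by (rule super[OF X])
  then have 2: "\<Phi> (L - j) ((shift ^^ j) ?x) + \<Phi> (t * L) ((shift ^^ L) ?x) \<le> \<Phi> (L - j + t * L) ((shift ^^ j) ?x)"
    using j by (simp add: sh)
  have 3: "\<Phi> (L - j + t * L) ((shift ^^ j) ?x) + \<Phi> j ((shift ^^ (L - j + t * L)) ((shift ^^ j) ?x)) \<le>
      \<Phi> (L - j + t * L + j) ((shift ^^ j) ?x)" by (rule super[OF X])
  have "L - j + t * L + j = Suc t * L" using j by simp
  moreover have "\<bar>\<Phi> (L - j) ((shift ^^ j) ?x)\<bar> \<le> B2" by (rule B2[OF X]) simp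
  moreover have "\<bar>\<Phi> j ((shift ^^ (L - j + t * L)) ((shift ^^ j) ?x))\<bar> \<le> B2"
    using j by (intro B2 funpow_shift_in_subshift X) simp
  ultimately show ?thesis using 1 2 3 by (simp add: coding_def)
qed

lemma integral_\<mu>_lower_bound:
  assumes B: "\<And>x. x \<in> subshift T \<Longrightarrow> \<bar>\<Phi> (K - 1) x\<bar> \<le> B"
  obtains C where "\<And>t. real t * (mean - B) - C \<le> (\<integral>x. \<Phi> (Suc t * L) x \<partial>\<mu>)"
proof -
  interpret tower: prob_space tower by (rule prob_space_tower)
  obtain B2 where B2: "\<And>x r. x \<in> subshift T \<Longrightarrow> r \<le> L \<Longrightarrow> \<bar>\<Phi> r x\<bar> \<le> B2"
    using bound_upto by metis
  show thesis
  proof (rule that)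
    fix t
    note int\<mu> = integrable_potential[OF \<mu>_invariant, of "Suc t * L" 0, unfolded funpow_0]
    have meas: "\<Phi> (Suc t * L) \<in> borel_measurable (borel_subshift T)"
      by (rule borel_measurable_continuous_on_restrict[OF continuous])
    have "real t * (mean - B) - 2 * B2 = (\<integral>z. (\<Sum>b<t. psi m (fst z (Suc b)) - B) - 2 * B2 \<partial>tower)"
      by (simp add: integral_tower_psi tower.prob_space Bochner_Integration.integral_sum)
    also have "\<dots> \<le> (\<integral>z. \<Phi> (Suc t * L) (coding z) \<partial>tower)"
    proof (rule integral_mono)
      show "integrable tower (\<lambda>z. (\<Sum>b<t. psi m (fst z (Suc b)) - B) - 2 * B2)"
        by (intro Bochner_Integration.integrable_diff Bochner_Integration.integrable_sum
            integral_tower_psi tower.integrable_const)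
      show "integrable tower (\<lambda>z. \<Phi> (Suc t * L) (coding z))"
        using int\<mu> unfolding \<mu>_def by (rule integrable_distr[OF measurable_coding])
      fix z assume z: "z \<in> space tower"
      obtain \<omega> j where [simp]: "z = (\<omega>, j)" by (cases z)
      show "(\<Sum>b<t. psi m (fst z (Suc b)) - B) - 2 * B2 \<le> \<Phi> (Suc t * L) (coding z)"
        using potential_coding[OF B B2, of \<omega> j t] z by (simp add: space_tower)
    qed
    also have "\<dots> = (\<integral>x. \<Phi> (Suc t * L) x \<partial>\<mu>)"
      unfolding \<mu>_def by (rule integral_distr[OF measurable_coding meas, symmetric])
    finally show "real t * (mean - B) - 2 * B2 \<le> (\<integral>x. \<Phi> (Suc t * L) x \<partial>\<mu>)" .
  qed
qed

text \<open>By independence the information is the sum of the terms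
  \<open>- ln (pr (\<omega> i))\<close>. Only the words 1 to \<open>t\<close> count, because word 0
  may be cut off by the offset.\<close>

lemma rv_entropy_words:
  "rv_entropy words (\<lambda>\<omega>. \<lambda>i\<in>{1..t}. \<omega> i) = real t * (ln (Z m) - mean)"
proof -
  interpret words: prob_space words by (rule prob_space_words)
  interpret product_prob_space "\<lambda>_::nat. letter" UNIV
    by (intro product_prob_spaceI prob_space_letter)
  have info: "info words (\<lambda>\<omega>. \<lambda>i\<in>{1..t}. \<omega> i) \<omega> = (\<Sum>i\<in>{1..t}. ln (Z m) - psi m (\<omega> i))"
    if \<omega>: "\<omega> \<in> space words" for \<omega>
  proof -
    have "{\<omega>' \<in> space words. (\<lambda>i\<in>{1..t}. \<omega>' i) = (\<lambda>i\<in>{1..t}. \<omega> i)} =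
        {\<omega>' \<in> space words. \<forall>i\<in>{1..t}. \<omega>' i \<in> {\<omega> i}}"
      by (auto simp: fun_eq_iff restrict_def split: if_splits)
    then have "emeasure words {\<omega>' \<in> space words. (\<lambda>i\<in>{1..t}. \<omega>' i) = (\<lambda>i\<in>{1..t}. \<omega> i)} =
        (\<Prod>i\<in>{1..t}. emeasure letter {\<omega> i})"
    proof (simp only:)
      have "{\<omega> i} \<in> sets letter" for i
        using \<omega> by (simp add: letter_def sets_point_measure space_words)
      then show "emeasure words {\<omega>' \<in> space words. \<forall>i\<in>{1..t}. \<omega>' i \<in> {\<omega> i}} =
          (\<Prod>i\<in>{1..t}. emeasure letter {\<omega> i})"
        unfolding words_def by (intro emeasure_PiM_Collect) auto
    qed
    also have "\<dots> = (\<Prod>i\<in>{1..t}. ennreal (pr (\<omega> i)))"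
      using \<omega> by (intro prod.cong refl) (simp add: letter_def emeasure_point_measure_finite finite_W space_words)
    also have "\<dots> = ennreal (\<Prod>i\<in>{1..t}. pr (\<omega> i))"
      by (rule prod_ennreal) (simp add: pr_pos less_imp_le)
    finally have "measure words {\<omega>' \<in> space words. (\<lambda>i\<in>{1..t}. \<omega>' i) = (\<lambda>i\<in>{1..t}. \<omega> i)} =
        (\<Prod>i\<in>{1..t}. pr (\<omega> i))"
      by (simp add: measure_def prod_nonneg pr_pos less_imp_le)
    then have "info words (\<lambda>\<omega>. \<lambda>i\<in>{1..t}. \<omega> i) \<omega> = - (\<Sum>i\<in>{1..t}. ln (pr (\<omega> i)))"
      unfolding info_def by (simp add: ln_prod pr_pos less_imp_neq[OF pr_pos, THEN not_sym])
    also have "\<dots> = (\<Sum>i\<in>{1..t}. ln (Z m) - psi m (\<omega> i))"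
      unfolding pr_def sum_negf[symmetric] using Z_pos' by (intro sum.cong refl) (simp add: ln_div)
    finally show ?thesis .
  qed
  have "rv_entropy words (\<lambda>\<omega>. \<lambda>i\<in>{1..t}. \<omega> i) = (\<integral>\<omega>. (\<Sum>i\<in>{1..t}. ln (Z m) - psi m (\<omega> i)) \<partial>words)"
    unfolding rv_entropy_def by (rule Bochner_Integration.integral_cong[OF refl info])
  also have "\<dots> = real t * (ln (Z m) - mean)"
    by (simp add: Bochner_Integration.integral_sum integral_words_psi words.prob_space)
  finally show ?thesis .
qed

text \<open>The first \<open>Suc t * L\<close> letters of a coded point and its offset determine the
  words 1 to \<open>t\<close>. Forgetting the offset costs \<open>ln L\<close>, and the letter
  itinerary determines the letters.\<close>

lemma entropy_\<mu>_lower_bound: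
  "real t * (ln (Z m) - mean) - ln L \<le> rv_entropy \<mu> (itinerary shift (letter_partition T) (Suc t * L))"
proof -
  interpret tower: prob_space tower by (rule prob_space_tower)
  let ?n = "Suc t * L"
  let ?\<beta> = "\<lambda>\<omega>::nat \<Rightarrow> nat list. \<lambda>i\<in>{1..t}. \<omega> i"
  have sets: "sets \<mu> = sets (borel_subshift T)" by (simp add: \<mu>_def)
  have space: "space \<mu> = subshift T" using sets_eq_imp_space_eq[OF sets] by simp
  interpret \<mu>: prob_space \<mu> by (rule invariant_measuresD(1)[OF \<mu>_invariant])
  have sf_beta: "simple_function words ?\<beta>"
    using simple_function_coord[of "\<lambda>w. w"] by (intro simple_function_restrict) auto
  have sf_fst: "simple_function tower (\<lambda>z. ?\<beta> (fst z))"
    by (rule simple_function_measurable_comp[OF measurable_fst_tower sf_beta])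
  have sf_word: "simple_function tower (\<lambda>z. word ?n (coding z))"
    by (rule simple_function_measurable_comp[OF measurable_coding simple_function_word[OF refl]])
  have sf_snd: "simple_function tower snd"
  proof -
    have "snd \<in> measurable tower offset" unfolding tower_def by (rule measurable_snd)
    moreover have "simple_function offset (\<lambda>j. j)"
      unfolding simple_function_def offset_def
      by (auto simp: space_uniform_count_measure sets_uniform_count_measure)
    ultimately show ?thesis by (rule simple_function_measurable_comp)
  qed
  have "real t * (ln (Z m) - mean) = rv_entropy tower (\<lambda>z. ?\<beta> (fst z))"
    using rv_entropy_distr[OF measurable_fst_tower sf_beta] by (simp only: distr_tower_fst rv_entropy_words)
  also have "\<dots> \<le> rv_entropy tower (\<lambda>z. (word ?n (coding z), snd z))"
  proof (rule tower.rv_entropy_mono[OF sf_fst simple_function_pair[OF sf_word sf_snd]])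
    fix z z' assume z: "z \<in> space tower" "z' \<in> space tower"
      and eq: "(word ?n (coding z), snd z) = (word ?n (coding z'), snd z')"
    obtain \<omega> j \<omega>' where zz: "z = (\<omega>, j)" "z' = (\<omega>', j)" using eq by (cases z; cases z') auto
    have j: "j < L" and \<omega>: "\<And>i. \<omega> i \<in> W" "\<And>i. \<omega>' i \<in> W" using z by (auto simp: zz space_tower)
    have "\<omega> i = \<omega>' i" if i: "i \<in> {1..t}" for i
    proof (rule nth_equalityI)
      show "length (\<omega> i) = length (\<omega>' i)" using \<omega> W_length by simp
      fix r assume "r < length (\<omega> i)"
      then have r: "r < m" using \<omega> W_length by simp
      \<comment> \<open>From \<open>i \<ge> 1\<close> the position \<open>i * L + r - j\<close> is a
        genuine difference of naturals; from \<open>i \<le> t\<close> it lies inside the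
        window.\<close>
      have "L \<le> i * L" using i by simp
      then have k: "j \<le> i * L + r" using j by linarith
      have "i * L \<le> t * L" using i by simp
      then have "i * L + r - j < L + t * L" using r L(1) by linarith
      then have "coding (\<omega>, j) (i * L + r - j) = coding (\<omega>', j) (i * L + r - j)"
        using eq by (simp add: zz word_eq_iff)
      then show "\<omega> i ! r = \<omega>' i ! r"
        using k by (simp add: coding_def funpow_shift concat_words_block[OF r])
    qed
    then show "?\<beta> (fst z) = ?\<beta> (fst z')" by (auto simp: zz)
  qed
  also have "\<dots> \<le> rv_entropy tower (\<lambda>z. word ?n (coding z)) + ln (card {..<L})"
  proof (rule tower.rv_entropy_pair_card[OF sf_word sf_snd])
    show "snd ` space tower \<subseteq> {..<L}"
      by (simp add: tower_def space_pair_measure space_offset image_subset_iff)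
  qed simp
  also have "rv_entropy tower (\<lambda>z. word ?n (coding z)) = rv_entropy \<mu> (word ?n)"
    unfolding \<mu>_def by (rule rv_entropy_distr[OF measurable_coding simple_function_word[OF refl], symmetric])
  also have "\<dots> \<le> rv_entropy \<mu> (itinerary shift (letter_partition T) ?n)"
    by (rule \<mu>.rv_entropy_mono[OF simple_function_word[OF sets]
          simple_function_itinerary[OF letter_partition_measurable[OF sets] invariant_measuresD(4)[OF \<mu>_invariant]]])
      (auto simp: space intro: itinerary_letter_partition_imp_word)
  finally show ?thesis by simp
qed

text \<open>Adding the bounds for entropy and potential cancels \<open>mean\<close>. The limit is
  taken along the multiples of \<open>L\<close>, where both bounds are available.\<close>

lemma P_meas_lower_bound:
  assumes B: "\<And>x. x \<in> subshift T \<Longrightarrow> \<bar>\<Phi> (K - 1) x\<bar> \<le> B"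
  shows "ereal ((ln (Z m) - B) / L) \<le> P_meas T \<Phi>"
proof -
  let ?P = "letter_partition T"
  have sets: "sets \<mu> = sets (borel_subshift T)" by (simp add: \<mu>_def)
  have P: "finite_measurable_partition \<mu> ?P" by (rule letter_partition_measurable[OF sets])
  note \<mu> = invariant_measuresD[OF \<mu>_invariant]
  obtain C where C: "\<And>t. real t * (mean - B) - C \<le> (\<integral>x. \<Phi> (Suc t * L) x \<partial>\<mu>)"
    using integral_\<mu>_lower_bound[OF B] by metis
  let ?h = "entropy_wrt_partition \<mu> shift ?P" and ?F = "asymptotic_mean \<Phi> \<mu>"
  let ?f = "\<lambda>n. ereal (rv_entropy \<mu> (itinerary shift ?P n) / real n) + ereal ((\<integral>x. \<Phi> n x \<partial>\<mu>) / real n)"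
  \<comment> \<open>Together with \<open>F0\<close> this excludes adding \<open>\<infinity>\<close>
    and \<open>- \<infinity>\<close> in the limit.\<close>
  have h0: "0 \<le> ?h" by (rule entropy_wrt_partition_nonneg[OF \<mu>(1) P \<mu>(4,5)])
  have "ereal ((\<integral>x. \<Phi> 1 x \<partial>\<mu>) / real 1) \<le> ?F"
    unfolding asymptotic_mean_LIMSEQ(2)[OF \<mu>_invariant] by (intro SUP_upper) auto
  then have F0: "?F \<noteq> - \<infinity>" by auto
  have "?f \<longlonglongrightarrow> ?h + ?F"
    using h0 F0
    by (intro tendsto_add_ereal_general asymptotic_mean_LIMSEQ(1)[OF \<mu>_invariant]
        entropy_wrt_partition_LIMSEQ[OF \<mu>(1) P \<mu>(4,5)]) auto
  moreover have "strict_mono (\<lambda>t. Suc t * L)" using L(2) by (auto simp: strict_mono_Suc_iff)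
  ultimately have lim: "(\<lambda>t. ?f (Suc t * L)) \<longlonglongrightarrow> ?h + ?F"
    by (auto dest: LIMSEQ_subseq_LIMSEQ simp: comp_def)
  \<comment> \<open>The lower bound divided by \<open>Suc t * L\<close>, rewritten as its limit
    minus a multiple of \<open>inverse (real (Suc t))\<close>.\<close>
  let ?g = "\<lambda>t. (ln (Z m) - B) / L - (ln (Z m) - B + C + ln L) / L * inverse (real (Suc t))"
  have "?g \<longlonglongrightarrow> (ln (Z m) - B) / L - (ln (Z m) - B + C + ln L) / L * 0"
    by (intro tendsto_intros LIMSEQ_inverse_real_of_nat)
  then have "(\<lambda>t. ereal (?g t)) \<longlonglongrightarrow> ereal ((ln (Z m) - B) / L)" by simp
  then have "ereal ((ln (Z m) - B) / L) \<le> ?h + ?F"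
  proof (rule LIMSEQ_le[OF _ lim], intro exI allI impI)
    fix t :: nat
    have "real t * (ln (Z m) - B) - C - ln L \<le>
        rv_entropy \<mu> (itinerary shift ?P (Suc t * L)) + (\<integral>x. \<Phi> (Suc t * L) x \<partial>\<mu>)"
      using C[of t] entropy_\<mu>_lower_bound[of t] by (simp add: algebra_simps)
    then have "(real t * (ln (Z m) - B) - C - ln L) / real (Suc t * L) \<le>
        (rv_entropy \<mu> (itinerary shift ?P (Suc t * L)) + (\<integral>x. \<Phi> (Suc t * L) x \<partial>\<mu>)) / real (Suc t * L)"
      by (rule divide_right_mono) simp
    moreover have "?g t = (real t * (ln (Z m) - B) - C - ln L) / real (Suc t * L)"
    proof -
      have "x / l - (x + c + d) / l * inverse s = ((s - 1) * x - c - d) / (s * l)"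
        if "s > 0" "l > 0" for x c d l s :: real
        using that by (simp add: field_simps)
      from this[of "real (Suc t)" "real L" "ln (Z m) - B" C "ln L"] show ?thesis
        using L(2) by (simp only: of_nat_mult) simp
    qed
    ultimately show "ereal (?g t) \<le> ?f (Suc t * L)" by (simp add: add_divide_distrib)
  qed
  also have "\<dots> \<le> KS_entropy \<mu> shift + ?F"
    unfolding KS_entropy_def using P by (intro add_right_mono SUP_upper) auto
  also have "\<dots> \<le> P_meas T \<Phi>"
    unfolding P_meas_def using \<mu>_invariant by (rule SUP_upper)
  finally show ?thesis .
qed

end

section \<open>The variational principle\<close>

text \<open>A positive entry of a product has a nonzero summand, which supplies the last
  intermediate letter; a nonzero entry of \<open>T\<close> is 1.\<close>

lemma mat_power_path:
  assumes T: "T \<in> carrier_mat q q" and el: "elements_mat T \<subseteq> {0, 1 :: nat}"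
    and ab: "a < q" "b < q" "(T ^\<^sub>m k) $$ (a, b) > 0"
  shows "\<exists>s. s 0 = a \<and> s k = b \<and> (\<forall>i\<le>k. s i < q) \<and> (\<forall>i<k. T $$ (s i, s (Suc i)) = 1)"
  using ab
proof (induction k arbitrary: b)
  case 0
  then have "a = b" using T by (auto split: if_splits)
  then show ?case using 0 by (intro exI[of _ "\<lambda>_. a"]) auto
next
  case (Suc k)
  have "T ^\<^sub>m k \<in> carrier_mat q q" using T by (rule pow_carrier_mat)
  then have "(T ^\<^sub>m Suc k) $$ (a, b) = (\<Sum>c<q. (T ^\<^sub>m k) $$ (a, c) * T $$ (c, b))"
    using T Suc.prems by (simp add: scalar_prod_def lessThan_atLeast0)
  then have "(\<Sum>c<q. (T ^\<^sub>m k) $$ (a, c) * T $$ (c, b)) \<noteq> 0" using Suc.prems(3) by linarith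
  then obtain c where c: "c < q" "(T ^\<^sub>m k) $$ (a, c) * T $$ (c, b) \<noteq> 0"
    by (meson lessThan_iff sum.not_neutral_contains_not_neutral)
  then obtain s where s: "s 0 = a" "s k = c" "\<forall>i\<le>k. s i < q" "\<forall>i<k. T $$ (s i, s (Suc i)) = 1"
    using Suc.IH[of c] Suc.prems by auto
  have "T $$ (c, b) \<in> elements_mat T" using T c(1) Suc.prems by (intro elements_matI) auto
  then have "T $$ (c, b) = 1" using el c(2) by auto
  then show ?case using s c(1) Suc.prems
    by (intro exI[of _ "s(Suc k := b)"]) (auto simp: less_Suc_eq le_Suc_eq)
qed

lemma (in superadditive_potential) P_top_eq_Z:
  "P_top T \<Phi> = lim (\<lambda>n. ereal (ln (Z n) / real n))"
  by (simp add: P_top_def Z_def psi_def)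

lemma superadditive_set_zero:
  assumes "superadditive T \<Phi>"
  shows "superadditive_potential T (\<lambda>n x. if n = 0 then 0 else \<Phi> n x)"
proof
  have cont: "\<And>n. n \<ge> 1 \<Longrightarrow> continuous_on (subshift T) (\<Phi> n)"
    and super: "\<And>n m x. n \<ge> 1 \<Longrightarrow> m \<ge> 1 \<Longrightarrow> x \<in> subshift T \<Longrightarrow>
      \<Phi> n x + \<Phi> m ((shift ^^ n) x) \<le> \<Phi> (n + m) x"
    using assms unfolding superadditive_def by auto
  show "continuous_on (subshift T) (\<lambda>x. if n = 0 then 0 else \<Phi> n x)" for n
    using cont[of n] by (cases "n = 0") auto
  show "(if n = 0 then 0 else \<Phi> n x) + (if m = 0 then 0 else \<Phi> m ((shift ^^ n) x)) \<le>
      (if n + m = 0 then 0 else \<Phi> (n + m) x)" if "x \<in> subshift T" for n m x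
    using super[of n m x] that by auto
qed simp

lemma P_top_set_zero: "P_top T (\<lambda>n x. if n = 0 then 0 else \<Phi> n x) = P_top T \<Phi>"
  unfolding P_top_def by (intro arg_cong[where f = lim] ext) auto

lemma P_meas_set_zero: "P_meas T (\<lambda>n x. if n = 0 then 0 else \<Phi> n x) = P_meas T \<Phi>"
proof -
  have "asymptotic_mean (\<lambda>n x. if n = 0 then 0 else \<Phi> n x) \<mu> = asymptotic_mean \<Phi> \<mu>" for \<mu>
  proof -
    have "ereal ((\<integral>x. (if n = 0 then 0 else \<Phi> n x) \<partial>\<mu>) / real n) = ereal ((\<integral>x. \<Phi> n x \<partial>\<mu>) / real n)" for n
      by (cases "n = 0") auto
    then show ?thesis by (simp only: asymptotic_mean_def)
  qed
  then show ?thesis by (simp add: P_meas_def)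
qed

text \<open>For finite \<open>P\<close> the hypothesis gives
  \<open>a n \<le> P * n + (P * d + B)\<close>, and the constant disappears after division by
  \<open>n\<close>. Here \<open>d\<close> stands for the \<open>K - 1\<close> letters by which a
  block exceeds its word.\<close>

lemma limsup_le_of_gap:
  fixes a :: "nat \<Rightarrow> real" and P :: ereal
  assumes gap: "\<And>n. n \<ge> 1 \<Longrightarrow> ereal ((a n - B) / (real n + d)) \<le> P" and d: "d \<ge> 0"
  shows "limsup (\<lambda>n. ereal (a n / real n)) \<le> P"
proof (cases P)
  case (real p)
  have "limsup (\<lambda>n. ereal (a n / real n)) \<le> limsup (\<lambda>n. ereal (p + (p * d + B) / real n))"
  proof (rule Limsup_mono, rule eventually_sequentiallyI[of 1])
    fix n :: nat assume n: "1 \<le> n"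
    then have "(a n - B) / (real n + d) \<le> p" using gap[OF n] real by simp
    then have "a n \<le> p * real n + (p * d + B)" using n d by (simp add: field_simps)
    then have "a n / real n \<le> (p * real n + (p * d + B)) / real n" by (rule divide_right_mono) simp
    then show "ereal (a n / real n) \<le> ereal (p + (p * d + B) / real n)"
      using n by (simp add: add_divide_distrib)
  qed
  also have "(\<lambda>n. p + (p * d + B) / real n) \<longlonglongrightarrow> p + 0"
    by (intro tendsto_intros lim_const_over_n)
  then have "limsup (\<lambda>n. ereal (p + (p * d + B) / real n)) = ereal p"
    by (intro lim_imp_Limsup) auto
  finally show ?thesis using real by simp
qed (use gap[of 1] in auto)

theorem proposition2p2:
  fixes q :: nat and T :: "nat mat" and \<Phi> :: "nat \<Rightarrow> (nat \<Rightarrow> nat) \<Rightarrow> real"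
  assumes "q \<ge> 1"
    and "T \<in> carrier_mat q q"
    and "elements_mat T \<subseteq> {0, 1}"
    and "primitive_mat T"
    and "superadditive T \<Phi>"
  shows "P_top T \<Phi> = P_meas T \<Phi>"
proof -
  define \<Psi> where "\<Psi> = (\<lambda>n x. if n = 0 then 0 else \<Phi> n x)"
  have dim: "dim_row T = q" using assms(2) by auto
  interpret superadditive_potential T \<Psi>
    unfolding \<Psi>_def by (rule superadditive_set_zero[OF assms(5)])
  obtain K where K: "K \<ge> 1" "\<forall>i<q. \<forall>j<q. (T ^\<^sub>m K) $$ (i, j) > 0"
    using assms(4) unfolding primitive_mat_def dim by auto
  have coding: "block_coding T \<Psi> K n" if "n \<ge> 1" for n
  proof
    show "1 \<le> dim_row T" using assms(1) dim by simp
    show "\<exists>s. s 0 = a \<and> s K = b \<and> (\<forall>i\<le>K. s i < dim_row T) \<and> (\<forall>i<K. T $$ (s i, s (Suc i)) = 1)"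
      if "a < dim_row T" "b < dim_row T" for a b
      using mat_power_path[OF assms(2,3), of a b K] K that dim by simp
  qed (use K that in auto)
  \<comment> \<open>Like \<open>K\<close>, chosen before \<open>n\<close>: the gap between
    \<open>ln (Z n)\<close> and the bound from the coded measure is uniform in
    \<open>n\<close>.\<close>
  obtain B where B: "\<And>x. x \<in> subshift T \<Longrightarrow> \<bar>\<Psi> (K - 1) x\<bar> \<le> B" using bound by metis
  let ?p = "\<lambda>n. ereal (ln (Z n) / real n)"
  have "limsup ?p \<le> P_meas T \<Psi>"
  proof (rule limsup_le_of_gap)
    show "ereal ((ln (Z n) - B) / (real n + real (K - 1))) \<le> P_meas T \<Psi>" if "n \<ge> 1" for n
      using block_coding.P_meas_lower_bound[OF coding[OF that] B] block_coding.L(4)[OF coding[OF that]] by simp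
  qed simp
  moreover have "P_meas T \<Psi> \<le> liminf ?p"
    unfolding P_meas_def using entropy_plus_mean_le_liminf by (intro SUP_least)
  \<comment> \<open>The chain from \<open>limsup\<close> through \<open>P_meas\<close> to
    \<open>liminf\<close> forces equality, so the \<open>lim\<close> in \<open>P_top\<close> is a
    true limit.\<close>
  ultimately have "liminf ?p = P_meas T \<Psi>" "limsup ?p = P_meas T \<Psi>"
    using Liminf_le_Limsup[of sequentially ?p] by auto
  then have "?p \<longlonglongrightarrow> P_meas T \<Psi>" by (intro Liminf_eq_Limsup) auto
  then have "P_top T \<Psi> = P_meas T \<Psi>" by (simp add: P_top_eq_Z limI)
  then show ?thesis by (simp add: \<Psi>_def P_top_set_zero P_meas_set_zero)
qed

end
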